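(* Let $\mathcal A$ be an additive category and let $M=(M_*,M^* )$ be a globally defined Mackey functor on finite groupoids with values in $\mathcal A$ which satisfies the surjections axiom. Then the restriction of $M$ to finite groups and group homomorphisms is a global Mackey functor in the sense of Webb (for the classes $\mathcal X=\mathcal Y=$ all finite groups); that is, it satisfies Webb's axioms (1)--(5).
   Context: A finite groupoid is a category with finitely many objects and arrows in which every arrow is invertible; maps of groupoids are functors. A finite group $G$ is regarded as the groupoid with one object and arrows $G$. The fibered product $\underline F=\underline K\times_{\underline G}\underline H$ of maps $\delta:\underline K\to\underline G$, $\gamma:\underline H\to\underline G$ has as objects the triples $(y,g,z)$ with $y$ an object of $\underline K$, $z$ an object of $\underline H$ and $g:\delta(y)\to\gamma(z)$ an arrow of $\underline G$; an arrow $(y,g,z)\to(y',g',z')$ is a pair of arrows $k:y\to y'$, $h:z\to z'$ with $g'\delta(k)=\gamma(h)g$. It has projections $\alpha:\underline F\to\underline H$ and $\beta:\underline F\to\underline K$. Globally defined Mackey functor with values in $\mathcal A$: a pair of functors $M=(M_*,M^* )$ from the category of finite groupoids to $\mathcal A$, $M_*$ covariant and $M^*$ contravariant, agreeing on objects (write $M(\underline G)$, $\phi_*=M_*(\phi)$, $\phi^*=M^*(\phi)$), such that: - (Coproducts) $M_*$ preserves (finite) coproducts and $M(\emptyset)=0$; - (Natural isomorphisms) if $\phi,\psi:\underline G\to\underline H$ are naturally isomorphic then $\phi_*=\psi_*$ and $\phi^*=\psi^*$; - (Equivalences) if $\phi$ is an equivalence of groupoids then $\phi_*$ and $\phi^*$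 are inverse isomorphisms; - (Fibered products) for all maps of finite groupoids $\delta:\underline K\to\underline G$ and $\gamma:\underline H\to\underline G$, with fibered product $\underline F=\underline K\times_{\underline G}\underline H$ and projections $\alpha:\underline F\to\underline H$ and $\beta:\underline F\to\underline K$, one has $\delta^*\circ\gamma_*=\beta_*\circ\alpha^*$. Surjections axiom: for every surjective homomorphism of finite groups $\phi:G\to H$, $\phi_*\phi^*=\mathrm{id}_{M(H)}$. Global Mackey functor in the sense of Webb ($\mathcal X,\mathcal Y$ all finite groups) with values in $\mathcal A$: an object $M(G)$ for every finite group $G$, and for every homomorphism $\alpha:G\to K$ of finite groups morphisms $\alpha_*:M(G)\to M(K)$ and $\alpha^*:M(K)\to M(G)$, such that: (1) $(\alpha\beta)_*=\alpha_*\beta_*$ and $(\alpha\beta)^*=\beta^*\alpha^*$, and identities go to identities; (2) if $\alpha:G\to G$ is an inner automorphism, then $\alpha_*=\mathrm{id}=\alpha^*$; (3) for every surjection $\beta:G\twoheadrightarrow H$ and subgroup inclusion $\alpha:K\hookrightarrow H$, with $\delta:\beta^{-1}(K)\hookrightarrow G$ the inclusion and $\gamma:\beta^{-1}(K)\twoheadrightarrow K$ the restriction of $\beta$, one has $\alpha^*\beta_*=\gamma_*\delta^*$ and $\beta^*\alpha_*=\delta_*\gamma^*$; (4) for all surjections $\beta:H\twoheadrightarrow G$, $\alpha:H\twoheadrightarrow K$, with induced surjections $\gamma:G\twoheadrightarrow H/(\ker\alpha\ker\beta)$ and $\delta:K\twoheadrightarrow H/(\ker\alpha\ker\beta)$,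 one has $\delta^*\gamma_*=\alpha_*\beta^*$; (5) (Mackey axiom) for all subgroups $J,K\le H$, writing $\mathrm{ind}=\iota_*$ and $\mathrm{res}=\iota^*$ for inclusions $\iota$ and $c_x:J\cap x^{-1}Kx\to xJx^{-1}\cap K$ for conjugation by $x$, $$\mathrm{res}^H_K\,\mathrm{ind}_J^H=\sum_{x\in K\backslash H/J}\mathrm{ind}^K_{K\cap xJx^{-1}}\,(c_x)_*\,\mathrm{res}^J_{x^{-1}Kx\cap J}.$$ *)

theory Defs
  imports "HOL-Library.Infinite_Typeclass" "HOL-Algebra.Coset" "HOL-Algebra.FiniteProduct"
begin

section \<open>Categories and additive categories\<close>

record ('o, 'm) cat =
  Obj :: "'o set"
  Arr :: "'m set"
  Dom :: "'m \<Rightarrow> 'o"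
  Cod :: "'m \<Rightarrow> 'o"
  Idn :: "'o \<Rightarrow> 'm"
  Cmp :: "'m \<Rightarrow> 'm \<Rightarrow> 'm" (infixl "\<bullet>\<index>" 70)

text \<open>The composite \<open>g \<bullet> f\<close> means ``first \<open>f\<close>, then \<open>g\<close>''.\<close>

definition Hom :: "('o, 'm, 'z) cat_scheme \<Rightarrow> 'o \<Rightarrow> 'o \<Rightarrow> 'm set" where
  "Hom C X Y = {f \<in> Arr C. Dom C f = X \<and> Cod C f = Y}"

locale category =
  fixes C :: "('o, 'm, 'z) cat_scheme" (structure)
  assumes Dom_closed: "f \<in> Arr C \<Longrightarrow> Dom C f \<in> Obj C"
    and Cod_closed: "f \<in> Arr C \<Longrightarrow> Cod C f \<in> Obj C"
    and Idn_in_Hom: "X \<in> Obj C \<Longrightarrow> Idn C X \<in> Hom C X X"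
    and Cmp_in_Hom: "f \<in> Hom C X Y \<Longrightarrow> g \<in> Hom C Y Z \<Longrightarrow> g \<bullet> f \<in> Hom C X Z"
    and Cmp_Idn_left: "f \<in> Hom C X Y \<Longrightarrow> Idn C Y \<bullet> f = f"
    and Cmp_Idn_right: "f \<in> Hom C X Y \<Longrightarrow> f \<bullet> Idn C X = f"
    and Cmp_assoc: "f \<in> Hom C W X \<Longrightarrow> g \<in> Hom C X Y \<Longrightarrow> h \<in> Hom C Y Z \<Longrightarrow>
      h \<bullet> (g \<bullet> f) = (h \<bullet> g) \<bullet> f"

definition mutually_inverse :: "('o, 'm, 'z) cat_scheme \<Rightarrow> 'm \<Rightarrow> 'm \<Rightarrow> bool" where
  "mutually_inverse C f g \<longleftrightarrow>
     f \<in> Arr C \<and> g \<in> Hom C (Cod C f) (Dom C f) \<and>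
     g \<bullet>\<^bsub>C\<^esub> f = Idn C (Dom C f) \<and> f \<bullet>\<^bsub>C\<^esub> g = Idn C (Cod C f)"

definition invertible_arr :: "('o, 'm, 'z) cat_scheme \<Rightarrow> 'm \<Rightarrow> bool" where
  "invertible_arr C f \<longleftrightarrow> (\<exists>g. mutually_inverse C f g)"

definition zero_object :: "('o, 'm, 'z) cat_scheme \<Rightarrow> 'o \<Rightarrow> bool" where
  "zero_object C Z \<longleftrightarrow>
     Z \<in> Obj C \<and> (\<forall>X\<in>Obj C. (\<exists>!f. f \<in> Hom C Z X) \<and> (\<exists>!f. f \<in> Hom C X Z))"

text \<open>The cospan \<open>i\<close>, \<open>j\<close> exhibits its common codomain as a coproduct of the two domains.\<close>

definition is_coproduct :: "('o, 'm, 'z) cat_scheme \<Rightarrow> 'm \<Rightarrow> 'm \<Rightarrow> bool" where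
  "is_coproduct C i j \<longleftrightarrow>
     i \<in> Arr C \<and> j \<in> Arr C \<and> Cod C i = Cod C j \<and>
     (\<forall>Y\<in>Obj C. \<forall>f\<in>Hom C (Dom C i) Y. \<forall>g\<in>Hom C (Dom C j) Y.
        \<exists>!h. h \<in> Hom C (Cod C i) Y \<and> h \<bullet>\<^bsub>C\<^esub> i = f \<and> h \<bullet>\<^bsub>C\<^esub> j = g)"

locale is_functor = source: category C + target: category D
  for C :: "('o1, 'm1, 'z1) cat_scheme" and D :: "('o2, 'm2, 'z2) cat_scheme" +
  fixes F0 :: "'o1 \<Rightarrow> 'o2" and F1 :: "'m1 \<Rightarrow> 'm2"
  assumes map_Obj: "X \<in> Obj C \<Longrightarrow> F0 X \<in> Obj D"
    and map_Hom: "f \<in> Hom C X Y \<Longrightarrow> F1 f \<in> Hom D (F0 X) (F0 Y)"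
    and map_Idn: "X \<in> Obj C \<Longrightarrow> F1 (Idn C X) = Idn D (F0 X)"
    and map_Cmp: "f \<in> Hom C X Y \<Longrightarrow> g \<in> Hom C Y Z \<Longrightarrow>
      F1 (g \<bullet>\<^bsub>C\<^esub> f) = F1 g \<bullet>\<^bsub>D\<^esub> F1 f"

definition opposite :: "('o, 'm) cat \<Rightarrow> ('o, 'm) cat" where
  "opposite C = \<lparr>Obj = Obj C, Arr = Arr C, Dom = Cod C, Cod = Dom C, Idn = Idn C,
                 Cmp = (\<lambda>g f. f \<bullet>\<^bsub>C\<^esub> g)\<rparr>"

record ('o, 'm) additive_cat = "('o, 'm) cat" +
  Add :: "'m \<Rightarrow> 'm \<Rightarrow> 'm" (infixl "\<boxplus>\<index>" 65)
  Zero :: "'o \<Rightarrow> 'o \<Rightarrow> 'm"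

definition hom_group :: "('o, 'm, 'z) additive_cat_scheme \<Rightarrow> 'o \<Rightarrow> 'o \<Rightarrow> 'm monoid" where
  "hom_group A X Y = \<lparr>carrier = Hom A X Y, mult = Add A, one = Zero A X Y\<rparr>"

locale additive_category = category A for A :: "('o, 'm, 'z) additive_cat_scheme" (structure) +
  assumes hom_comm_group: "X \<in> Obj A \<Longrightarrow> Y \<in> Obj A \<Longrightarrow> comm_group (hom_group A X Y)"
    and Cmp_Add_right: "f \<in> Hom A X Y \<Longrightarrow> f' \<in> Hom A X Y \<Longrightarrow> g \<in> Hom A Y Z \<Longrightarrow>
      g \<bullet> (f \<boxplus> f') = g \<bullet> f \<boxplus> g \<bullet> f'"
    and Cmp_Add_left: "f \<in> Hom A X Y \<Longrightarrow> g \<in> Hom A Y Z \<Longrightarrow> g' \<in> Hom A Y Z \<Longrightarrow>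
      (g \<boxplus> g') \<bullet> f = g \<bullet> f \<boxplus> g' \<bullet> f"
    and ex_zero_object: "\<exists>Z. zero_object A Z"
    and ex_biproduct: "X \<in> Obj A \<Longrightarrow> Y \<in> Obj A \<Longrightarrow>
      \<exists>S\<in>Obj A. \<exists>i\<in>Hom A X S. \<exists>j\<in>Hom A Y S. \<exists>p\<in>Hom A S X. \<exists>q\<in>Hom A S Y.
        p \<bullet> i = Idn A X \<and> q \<bullet> j = Idn A Y \<and> i \<bullet> p \<boxplus> j \<bullet> q = Idn A S"

section \<open>The category of finite groupoids\<close>

definition finite_groupoid :: "('o, 'm) cat \<Rightarrow> bool" where
  "finite_groupoid G \<longleftrightarrow>
     category G \<and> finite (Obj G) \<and> finite (Arr G) \<and> (\<forall>f\<in>Arr G. invertible_arr G f)"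

text \<open>All finite groupoids and finite groups live on one infinite type \<open>'u\<close>, into which every
  finite set embeds; so every finite groupoid has an isomorphic copy there.  Constructions that
  leave \<open>'u\<close> (fibered products, quotient groups) are represented by \<^emph>\<open>every\<close> isomorphic copy
  of them on \<open>'u\<close>.\<close>

type_synonym 'u gpd = "('u, 'u) cat"

record 'u gpd_map =
  Src :: "'u gpd"
  Tgt :: "'u gpd"
  OMap :: "'u \<Rightarrow> 'u"
  AMap :: "'u \<Rightarrow> 'u"

definition FinGpd :: "('u gpd, 'u gpd_map) cat" where
  "FinGpd = \<lparr>
     Obj = {G. finite_groupoid G},
     Arr = {\<phi>. finite_groupoid (Src \<phi>) \<and> finite_groupoid (Tgt \<phi>) \<and>
               is_functor (Src \<phi>) (Tgt \<phi>) (OMap \<phi>) (AMap \<phi>) \<and>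
               OMap \<phi> \<in> extensional (Obj (Src \<phi>)) \<and> AMap \<phi> \<in> extensional (Arr (Src \<phi>))},
     Dom = Src,
     Cod = Tgt,
     Idn = (\<lambda>G. \<lparr>Src = G, Tgt = G, OMap = (\<lambda>x\<in>Obj G. x), AMap = (\<lambda>f\<in>Arr G. f)\<rparr>),
     Cmp = (\<lambda>\<psi> \<phi>. \<lparr>Src = Src \<phi>, Tgt = Tgt \<psi>,
                    OMap = compose (Obj (Src \<phi>)) (OMap \<psi>) (OMap \<phi>),
                    AMap = compose (Arr (Src \<phi>)) (AMap \<psi>) (AMap \<phi>)\<rparr>)\<rparr>"

definition naturally_isomorphic :: "'u gpd_map \<Rightarrow> 'u gpd_map \<Rightarrow> bool" where
  "naturally_isomorphic \<phi> \<psi> \<longleftrightarrow>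
     \<phi> \<in> Arr FinGpd \<and> \<psi> \<in> Arr FinGpd \<and> Src \<phi> = Src \<psi> \<and> Tgt \<phi> = Tgt \<psi> \<and>
     (\<exists>\<eta>. (\<forall>x\<in>Obj (Src \<phi>). \<eta> x \<in> Hom (Tgt \<phi>) (OMap \<phi> x) (OMap \<psi> x) \<and> invertible_arr (Tgt \<phi>) (\<eta> x)) \<and>
          (\<forall>x y. \<forall>f\<in>Hom (Src \<phi>) x y.
             \<eta> y \<bullet>\<^bsub>Tgt \<phi>\<^esub> AMap \<phi> f = AMap \<psi> f \<bullet>\<^bsub>Tgt \<phi>\<^esub> \<eta> x))"

definition gpd_equivalence :: "'u gpd_map \<Rightarrow> bool" where
  "gpd_equivalence \<phi> \<longleftrightarrow>
     \<phi> \<in> Arr FinGpd \<and>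
     (\<exists>\<psi>\<in>Hom FinGpd (Tgt \<phi>) (Src \<phi>).
        naturally_isomorphic (\<psi> \<bullet>\<^bsub>FinGpd\<^esub> \<phi>) (Idn FinGpd (Src \<phi>)) \<and>
        naturally_isomorphic (\<phi> \<bullet>\<^bsub>FinGpd\<^esub> \<psi>) (Idn FinGpd (Tgt \<phi>)))"

text \<open>The pair \<open>(k, h)\<close> and the source \<open>(y, g, z)\<close> determine the target of an arrow of the fibered
  product, but \<open>(k, h)\<close> alone does not determine its ends; so arrows carry both ends.\<close>

type_synonym 'u fib_obj = "'u \<times> 'u \<times> 'u"
type_synonym 'u fib_arr = "'u fib_obj \<times> ('u \<times> 'u) \<times> 'u fib_obj"

definition fibered_product ::
  "'u gpd_map \<Rightarrow> 'u gpd_map \<Rightarrow> ('u fib_obj, 'u fib_arr) cat" where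
  "fibered_product \<delta> \<gamma> =
     (let K = Src \<delta>; H = Src \<gamma>; G = Tgt \<delta>;
          Ob = {(y, g, z). y \<in> Obj K \<and> z \<in> Obj H \<and> g \<in> Hom G (OMap \<delta> y) (OMap \<gamma> z)}
      in \<lparr>Obj = Ob,
          Arr = {((y, g, z), (k, h), (y', g', z')).
                   (y, g, z) \<in> Ob \<and> (y', g', z') \<in> Ob \<and> k \<in> Hom K y y' \<and> h \<in> Hom H z z' \<and>
                   g' \<bullet>\<^bsub>G\<^esub> AMap \<delta> k = AMap \<gamma> h \<bullet>\<^bsub>G\<^esub> g},
          Dom = (\<lambda>(s, kh, t). s),
          Cod = (\<lambda>(s, kh, t). t),
          Idn = (\<lambda>(y, g, z). ((y, g, z), (Idn K y, Idn H z), (y, g, z))),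
          Cmp = (\<lambda>(s', (k', h'), t') (s, (k, h), t). (s, (k' \<bullet>\<^bsub>K\<^esub> k, h' \<bullet>\<^bsub>H\<^esub> h), t'))\<rparr>)"

text \<open>\<open>F\<close>, with \<open>\<alpha>\<close> to the source of \<open>\<gamma>\<close> and \<open>\<beta>\<close> to the source of \<open>\<delta>\<close>, is a copy of the fibered
  product of \<open>\<delta>\<close> and \<open>\<gamma>\<close> on the type \<open>'u\<close>: there is an isomorphism \<open>(T0, T1)\<close> of groupoids from
  \<open>F\<close> to it that turns \<open>\<alpha>\<close> and \<open>\<beta>\<close> into the projections.\<close>

definition is_fibered_product ::
  "'u gpd_map \<Rightarrow> 'u gpd_map \<Rightarrow> 'u gpd \<Rightarrow> 'u gpd_map \<Rightarrow> 'u gpd_map \<Rightarrow> bool" where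
  "is_fibered_product \<delta> \<gamma> F \<alpha> \<beta> \<longleftrightarrow>
     \<alpha> \<in> Hom FinGpd F (Src \<gamma>) \<and> \<beta> \<in> Hom FinGpd F (Src \<delta>) \<and>
     (\<exists>T0 T1. is_functor F (fibered_product \<delta> \<gamma>) T0 T1 \<and>
        bij_betw T0 (Obj F) (Obj (fibered_product \<delta> \<gamma>)) \<and>
        bij_betw T1 (Arr F) (Arr (fibered_product \<delta> \<gamma>)) \<and>
        (\<forall>x\<in>Obj F. case T0 x of (y, g, z) \<Rightarrow> OMap \<beta> x = y \<and> OMap \<alpha> x = z) \<and>
        (\<forall>f\<in>Arr F. case T1 f of (s, (k, h), t) \<Rightarrow> AMap \<beta> f = k \<and> AMap \<alpha> f = h))"

section \<open>Globally defined Mackey functors\<close>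

locale globally_defined_mackey_functor =
  fixes A :: "('o, 'm, 'z) additive_cat_scheme" (structure)
    and M :: "'u::infinite gpd \<Rightarrow> 'o"
    and push :: "'u gpd_map \<Rightarrow> 'm"
    and pull :: "'u gpd_map \<Rightarrow> 'm"
  assumes push_functor: "is_functor FinGpd A M push"
    and pull_functor: "is_functor (opposite FinGpd) A M pull"
    and coproducts: "is_coproduct FinGpd i j \<Longrightarrow> is_coproduct A (push i) (push j)"
    and empty_groupoid: "finite_groupoid G \<Longrightarrow> Obj G = {} \<Longrightarrow> zero_object A (M G)"
    and natural_isomorphisms:
      "naturally_isomorphic \<phi> \<psi> \<Longrightarrow> push \<phi> = push \<psi> \<and> pull \<phi> = pull \<psi>"
    and equivalences: "gpd_equivalence \<phi> \<Longrightarrow> mutually_inverse A (push \<phi>) (pull \<phi>)"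
    and fibered_products:
      "\<delta> \<in> Hom FinGpd K G \<Longrightarrow> \<gamma> \<in> Hom FinGpd H G \<Longrightarrow> is_fibered_product \<delta> \<gamma> F \<alpha> \<beta> \<Longrightarrow>
         pull \<delta> \<bullet> push \<gamma> = push \<beta> \<bullet> pull \<alpha>"

section \<open>Finite groups as groupoids\<close>

definition finite_group :: "('u, 'z) monoid_scheme \<Rightarrow> bool" where
  "finite_group G \<longleftrightarrow> group G \<and> finite (carrier G)"

text \<open>The single object of the groupoid of \<open>G\<close> is (arbitrarily) named by the unit of \<open>G\<close>.\<close>

definition gpd_of :: "'u monoid \<Rightarrow> 'u gpd" where
  "gpd_of G = \<lparr>Obj = {\<one>\<^bsub>G\<^esub>}, Arr = carrier G, Dom = (\<lambda>_. \<one>\<^bsub>G\<^esub>), Cod = (\<lambda>_. \<one>\<^bsub>G\<^esub>),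
               Idn = (\<lambda>_. \<one>\<^bsub>G\<^esub>), Cmp = mult G\<rparr>"

definition gpd_map_of :: "'u monoid \<Rightarrow> 'u monoid \<Rightarrow> ('u \<Rightarrow> 'u) \<Rightarrow> 'u gpd_map" where
  "gpd_map_of G H \<phi> = \<lparr>Src = gpd_of G, Tgt = gpd_of H,
                       OMap = (\<lambda>_\<in>{\<one>\<^bsub>G\<^esub>}. \<one>\<^bsub>H\<^esub>), AMap = (\<lambda>g\<in>carrier G. \<phi> g)\<rparr>"

definition surjections_axiom ::
  "('o, 'm, 'z) additive_cat_scheme \<Rightarrow> ('u gpd \<Rightarrow> 'o) \<Rightarrow> ('u gpd_map \<Rightarrow> 'm) \<Rightarrow> ('u gpd_map \<Rightarrow> 'm) \<Rightarrow> bool"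
  where
  "surjections_axiom A M push pull \<longleftrightarrow>
     (\<forall>G H \<phi>. finite_group G \<and> finite_group H \<and> \<phi> \<in> epi G H \<longrightarrow>
        push (gpd_map_of G H \<phi>) \<bullet>\<^bsub>A\<^esub> pull (gpd_map_of G H \<phi>) = Idn A (M (gpd_of H)))"

section \<open>Webb's global Mackey functors\<close>

abbreviation subgrp :: "'u monoid \<Rightarrow> 'u set \<Rightarrow> 'u monoid" where
  "subgrp H J \<equiv> H\<lparr>carrier := J\<rparr>"

definition conj_by :: "'u monoid \<Rightarrow> 'u \<Rightarrow> 'u \<Rightarrow> 'u" where
  "conj_by H x g = x \<otimes>\<^bsub>H\<^esub> g \<otimes>\<^bsub>H\<^esub> inv\<^bsub>H\<^esub> x"

definition double_coset :: "'u monoid \<Rightarrow> 'u set \<Rightarrow> 'u \<Rightarrow> 'u set \<Rightarrow> 'u set" where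
  "double_coset H K x J = K <#>\<^bsub>H\<^esub> (x <#\<^bsub>H\<^esub> J)"

definition double_coset_reps :: "'u monoid \<Rightarrow> 'u set \<Rightarrow> 'u set \<Rightarrow> 'u set \<Rightarrow> bool" where
  "double_coset_reps H K J R \<longleftrightarrow>
     R \<subseteq> carrier H \<and> (\<forall>h\<in>carrier H. \<exists>!x. x \<in> R \<and> h \<in> double_coset H K x J)"

text \<open>\<open>push G K \<alpha>\<close> and \<open>pull G K \<alpha>\<close> are the morphisms of \<open>\<alpha> : G \<rightarrow> K\<close>.  Elements of \<^term>\<open>hom G K\<close> are
  arbitrary outside the carrier; \<open>well_defined\<close> says that this does not matter.\<close>

locale webb_global_mackey_functor =
  fixes A :: "('o, 'm, 'z) additive_cat_scheme" (structure)
    and M :: "'u::infinite monoid \<Rightarrow> 'o"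
    and push :: "'u monoid \<Rightarrow> 'u monoid \<Rightarrow> ('u \<Rightarrow> 'u) \<Rightarrow> 'm"
    and pull :: "'u monoid \<Rightarrow> 'u monoid \<Rightarrow> ('u \<Rightarrow> 'u) \<Rightarrow> 'm"
  assumes M_Obj: "finite_group G \<Longrightarrow> M G \<in> Obj A"
    and push_Hom: "finite_group G \<Longrightarrow> finite_group K \<Longrightarrow> \<alpha> \<in> hom G K \<Longrightarrow>
      push G K \<alpha> \<in> Hom A (M G) (M K)"
    and pull_Hom: "finite_group G \<Longrightarrow> finite_group K \<Longrightarrow> \<alpha> \<in> hom G K \<Longrightarrow>
      pull G K \<alpha> \<in> Hom A (M K) (M G)"
    and well_defined: "finite_group G \<Longrightarrow> finite_group K \<Longrightarrow> \<alpha> \<in> hom G K \<Longrightarrow> \<alpha>' \<in> hom G K \<Longrightarrow>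
      \<forall>g\<in>carrier G. \<alpha> g = \<alpha>' g \<Longrightarrow> push G K \<alpha> = push G K \<alpha>' \<and> pull G K \<alpha> = pull G K \<alpha>'"
    and webb1_Cmp: "finite_group G \<Longrightarrow> finite_group H \<Longrightarrow> finite_group K \<Longrightarrow>
      \<beta> \<in> hom G H \<Longrightarrow> \<alpha> \<in> hom H K \<Longrightarrow>
      push G K (\<alpha> \<circ> \<beta>) = push H K \<alpha> \<bullet> push G H \<beta> \<and>
      pull G K (\<alpha> \<circ> \<beta>) = pull G H \<beta> \<bullet> pull H K \<alpha>"
    and webb1_Idn: "finite_group G \<Longrightarrow>
      push G G (\<lambda>g. g) = Idn A (M G) \<and> pull G G (\<lambda>g. g) = Idn A (M G)"
    and webb2: "finite_group G \<Longrightarrow> x \<in> carrier G \<Longrightarrow>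
      push G G (conj_by G x) = Idn A (M G) \<and> pull G G (conj_by G x) = Idn A (M G)"
    and webb3: "\<And>G H K \<beta> P. finite_group G \<Longrightarrow> finite_group H \<Longrightarrow> \<beta> \<in> epi G H \<Longrightarrow> subgroup K H \<Longrightarrow>
      P = {g \<in> carrier G. \<beta> g \<in> K} \<Longrightarrow>
      pull (subgrp H K) H (\<lambda>h. h) \<bullet> push G H \<beta> =
        push (subgrp G P) (subgrp H K) \<beta> \<bullet> pull (subgrp G P) G (\<lambda>g. g) \<and>
      pull G H \<beta> \<bullet> push (subgrp H K) H (\<lambda>h. h) =
        push (subgrp G P) G (\<lambda>g. g) \<bullet> pull (subgrp G P) (subgrp H K) \<beta>"
    and webb4: "finite_group H \<Longrightarrow> finite_group G \<Longrightarrow> finite_group K \<Longrightarrow>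
      \<beta> \<in> epi H G \<Longrightarrow> \<alpha> \<in> epi H K \<Longrightarrow>
      N = kernel H K \<alpha> <#>\<^bsub>H\<^esub> kernel H G \<beta> \<Longrightarrow>
      finite_group Q \<Longrightarrow> \<theta> \<in> iso (H Mod N) Q \<Longrightarrow>
      \<gamma> \<in> epi G Q \<Longrightarrow> \<delta> \<in> epi K Q \<Longrightarrow>
      \<forall>h\<in>carrier H. \<gamma> (\<beta> h) = \<theta> (N #>\<^bsub>H\<^esub> h) \<Longrightarrow>
      \<forall>h\<in>carrier H. \<delta> (\<alpha> h) = \<theta> (N #>\<^bsub>H\<^esub> h) \<Longrightarrow>
      pull K Q \<delta> \<bullet> push G Q \<gamma> = push H K \<alpha> \<bullet> pull H G \<beta>"
    and webb5: "\<And>H J K R. finite_group H \<Longrightarrow> subgroup J H \<Longrightarrow> subgroup K H \<Longrightarrow> double_coset_reps H K J R \<Longrightarrow>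
      pull (subgrp H K) H (\<lambda>h. h) \<bullet> push (subgrp H J) H (\<lambda>h. h) =
        (\<Otimes>\<^bsub>hom_group A (M (subgrp H J)) (M (subgrp H K))\<^esub> x\<in>R.
           (let Jx = J \<inter> conj_by H (inv\<^bsub>H\<^esub> x) ` K;
                xJ = conj_by H x ` J \<inter> K
            in push (subgrp H xJ) (subgrp H K) (\<lambda>h. h) \<bullet>
               push (subgrp H Jx) (subgrp H xJ) (conj_by H x) \<bullet>
               pull (subgrp H Jx) (subgrp H J) (\<lambda>h. h)))"

end

theory Submission
  imports Defs
begin

text \<open>Let \<open>F\<close> be the fibered product of homomorphisms \<open>\<delta> : K \<rightarrow> G\<close> and \<open>\<gamma> : H \<rightarrow> G\<close> of finite groups.  Its
  isomorphism classes are the double cosets \<open>\<gamma>(H) g \<delta>(K)\<close>, and the vertex group at \<open>g\<close> is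
  \<open>{(k, h). g \<delta>(k) = \<gamma>(h) g}\<close>.  For one vertex inclusion \<open>v\<^sub>i\<close> per isomorphism class of a groupoid
  the products \<open>v\<^sub>i\<^sup>* v\<^sub>j\<^sub>*\<close> are \<open>id\<close> or \<open>0\<close>, and the \<open>v\<^sub>i\<^sub>*\<close> are jointly epic because \<open>M\<^sub>*\<close> preserves
  coproducts; hence \<open>\<Sum> v\<^sub>i\<^sub>* v\<^sub>i\<^sup>* = id\<close>.  By the surjections axiom each \<open>v\<^sub>i\<close> may be replaced by a map from any
  group that surjects onto the vertex group.  Applied to \<open>F\<close> this turns \<open>\<delta>\<^sup>* \<gamma>\<^sub>*\<close> into a sum over double
  cosets, of which Webb's axioms (3), (4) and (5) are special cases.\<close>

section \<open>Functors between finite groupoids\<close>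

text \<open>Only \<open>push\<close> is assumed to preserve coproducts, and nothing is said about
  \<open>pull\<close> on a disjoint union; the identity of \<open>M F\<close> is therefore
  recognised by testing it against the vertex inclusions. The relations among these come from the
  fibered product axiom itself: the fibered product of a fully faithful map with itself is
  equivalent to its source and has naturally isomorphic projections, while maps into different
  isomorphism classes have an empty fibered product. Groups that merely surject onto the vertex
  groups are forced by axiom (4): there the vertex group consists of the pairs (k, g) with
  \<open>\<delta> k = \<gamma> g\<close>, and H maps onto it with kernel ker \<alpha> \<inter> ker
  \<beta>. A further obstacle is that fibered products leave the type \<open>'u\<close>, while the
  Mackey axiom speaks of their copies on \<open>'u\<close>; each use of it passes through a copy
  supplied by \<open>ex_comma_square\<close>.\<close>

lemma in_Hom_iff: "f \<in> Hom C X Y \<longleftrightarrow> f \<in> Arr C \<and> Dom C f = X \<and> Cod C f = Y"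
  by (simp add: Hom_def)

locale finite_gpd = category C for C :: "('o, 'm) cat" (structure) +
  assumes finite_groupoid: "finite_groupoid C"

lemma finite_gpdI: "finite_groupoid C \<Longrightarrow> finite_gpd C"
  by (simp add: finite_gpd_def finite_gpd_axioms_def finite_groupoid_def)

definition arr_inv :: "('o, 'm, 'z) cat_scheme \<Rightarrow> 'm \<Rightarrow> 'm" where
  "arr_inv C f = (SOME g. mutually_inverse C f g)"

context category
begin

lemma Hom_ends: "f \<in> Hom C x y \<Longrightarrow> x \<in> Obj C \<and> y \<in> Obj C"
  using Dom_closed Cod_closed by (auto simp: in_Hom_iff)

lemma Arr_in_Hom: "f \<in> Arr C \<Longrightarrow> f \<in> Hom C (Dom C f) (Cod C f)"
  by (simp add: in_Hom_iff)

end

context finite_gpd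
begin

lemma finite_Obj: "finite (Obj C)" and finite_Arr: "finite (Arr C)"
  using finite_groupoid by (auto simp: finite_groupoid_def)

lemma arr_inv_mutually_inverse: "f \<in> Arr C \<Longrightarrow> mutually_inverse C f (arr_inv C f)"
  using finite_groupoid unfolding finite_groupoid_def invertible_arr_def arr_inv_def
  by (simp add: someI_ex)

lemma invertible: "f \<in> Hom C x y \<Longrightarrow> invertible_arr C f"
  using finite_groupoid by (auto simp: finite_groupoid_def in_Hom_iff)

lemma arr_inv:
  assumes "f \<in> Hom C x y"
  shows arr_inv_in_Hom: "arr_inv C f \<in> Hom C y x"
    and arr_inv_left: "arr_inv C f \<bullet> f = Idn C x"
    and arr_inv_right: "f \<bullet> arr_inv C f = Idn C y"
  using assms arr_inv_mutually_inverse[of f] by (auto simp: mutually_inverse_def in_Hom_iff)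

lemma arr_inv_cancel:
  assumes "f \<in> Hom C x y"
  shows "g \<in> Hom C w x \<Longrightarrow> arr_inv C f \<bullet> (f \<bullet> g) = g"
    and "h \<in> Hom C w y \<Longrightarrow> f \<bullet> (arr_inv C f \<bullet> h) = h"
  using Cmp_assoc[OF _ assms arr_inv_in_Hom[OF assms]] Cmp_assoc[OF _ arr_inv_in_Hom[OF assms] assms]
  by (simp_all add: arr_inv[OF assms] Cmp_Idn_left)

lemma Cmp_left_cancel:
  assumes "f \<in> Hom C x y" "g \<in> Hom C w x" "g' \<in> Hom C w x" "f \<bullet> g = f \<bullet> g'"
  shows "g = g'"
  using arr_inv_cancel(1)[OF assms(1,2)] arr_inv_cancel(1)[OF assms(1,3)] assms(4) by metis

end

section \<open>Maps of finite groupoids and natural isomorphisms\<close>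

lemma FinGpd_simps [simp]:
  "Obj FinGpd = {G. finite_groupoid G}" "Dom FinGpd = Src" "Cod FinGpd = Tgt"
  "Idn FinGpd = (\<lambda>G. \<lparr>Src = G, Tgt = G, OMap = (\<lambda>x\<in>Obj G. x), AMap = (\<lambda>f\<in>Arr G. f)\<rparr>)"
  by (simp_all add: FinGpd_def)

lemma FinGpd_Cmp: "\<psi> \<bullet>\<^bsub>FinGpd\<^esub> \<phi> = \<lparr>Src = Src \<phi>, Tgt = Tgt \<psi>,
    OMap = compose (Obj (Src \<phi>)) (OMap \<psi>) (OMap \<phi>), AMap = compose (Arr (Src \<phi>)) (AMap \<psi>) (AMap \<phi>)\<rparr>"
  by (simp add: FinGpd_def)

lemma FinGpd_Cmp_simps [simp]:
  "Src (\<psi> \<bullet>\<^bsub>FinGpd\<^esub> \<phi>) = Src \<phi>" "Tgt (\<psi> \<bullet>\<^bsub>FinGpd\<^esub> \<phi>) = Tgt \<psi>"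
  "x \<in> Obj (Src \<phi>) \<Longrightarrow> OMap (\<psi> \<bullet>\<^bsub>FinGpd\<^esub> \<phi>) x = OMap \<psi> (OMap \<phi> x)"
  "f \<in> Arr (Src \<phi>) \<Longrightarrow> AMap (\<psi> \<bullet>\<^bsub>FinGpd\<^esub> \<phi>) f = AMap \<psi> (AMap \<phi> f)"
  by (simp_all add: FinGpd_def compose_def)

text \<open>Arrows of \<open>FinGpd\<close> are extensional, so both components are cut down to the
  carriers; maps built from formulas that agree there are then equal as records.\<close>

definition mk_map :: "'u gpd \<Rightarrow> 'u gpd \<Rightarrow> ('u \<Rightarrow> 'u) \<Rightarrow> ('u \<Rightarrow> 'u) \<Rightarrow> 'u gpd_map" where
  "mk_map C D p a = \<lparr>Src = C, Tgt = D, OMap = restrict p (Obj C), AMap = restrict a (Arr C)\<rparr>"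

lemma mk_map_simps [simp]:
  "Src (mk_map C D p a) = C" "Tgt (mk_map C D p a) = D"
  "x \<in> Obj C \<Longrightarrow> OMap (mk_map C D p a) x = p x"
  "f \<in> Arr C \<Longrightarrow> AMap (mk_map C D p a) f = a f"
  by (simp_all add: mk_map_def)

lemma mk_map_in_Hom:
  assumes "finite_groupoid C" "finite_groupoid D"
    and "\<And>x. x \<in> Obj C \<Longrightarrow> p x \<in> Obj D"
    and "\<And>f x y. f \<in> Hom C x y \<Longrightarrow> a f \<in> Hom D (p x) (p y)"
    and "\<And>x. x \<in> Obj C \<Longrightarrow> a (Idn C x) = Idn D (p x)"
    and "\<And>f g x y z. f \<in> Hom C x y \<Longrightarrow> g \<in> Hom C y z \<Longrightarrow> a (g \<bullet>\<^bsub>C\<^esub> f) = a g \<bullet>\<^bsub>D\<^esub> a f"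
  shows "mk_map C D p a \<in> Hom FinGpd C D"
proof -
  interpret C: finite_gpd C using assms(1) by (rule finite_gpdI)
  interpret D: finite_gpd D using assms(2) by (rule finite_gpdI)
  have "is_functor C D (restrict p (Obj C)) (restrict a (Arr C))"
  proof
    fix X assume "X \<in> Obj C" then show "restrict p (Obj C) X \<in> Obj D" using assms by simp
  next
    fix f X Y assume "f \<in> Hom C X Y"
    then show "restrict a (Arr C) f \<in> Hom D (restrict p (Obj C) X) (restrict p (Obj C) Y)"
      using assms(4)[of f X Y] C.Hom_ends[of f X Y] by (simp add: in_Hom_iff)
  next
    fix X assume "X \<in> Obj C"
    then show "restrict a (Arr C) (Idn C X) = Idn D (restrict p (Obj C) X)"
      using assms(5)[of X] C.Idn_in_Hom[of X] by (simp add: in_Hom_iff)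
  next
    fix f g X Y Z assume "f \<in> Hom C X Y" "g \<in> Hom C Y Z"
    then show "restrict a (Arr C) (g \<bullet>\<^bsub>C\<^esub> f) = restrict a (Arr C) g \<bullet>\<^bsub>D\<^esub> restrict a (Arr C) f"
      using assms(6)[of f X Y g Z] C.Cmp_in_Hom[of f X Y g Z] by (simp add: in_Hom_iff)
  qed
  then show ?thesis using assms(1,2) by (simp add: in_Hom_iff FinGpd_def mk_map_def)
qed

lemma gpd_map_Hom:
  assumes "\<phi> \<in> Hom FinGpd C D"
  shows gpd_map_Src: "Src \<phi> = C" and gpd_map_Tgt: "Tgt \<phi> = D"
    and gpd_map_finite_Src: "finite_groupoid C" and gpd_map_finite_Tgt: "finite_groupoid D"
    and gpd_map_Obj: "x \<in> Obj C \<Longrightarrow> OMap \<phi> x \<in> Obj D"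
    and gpd_map_Arr: "f \<in> Hom C x y \<Longrightarrow> AMap \<phi> f \<in> Hom D (OMap \<phi> x) (OMap \<phi> y)"
    and gpd_map_Idn: "x \<in> Obj C \<Longrightarrow> AMap \<phi> (Idn C x) = Idn D (OMap \<phi> x)"
    and gpd_map_Cmp: "f \<in> Hom C x y \<Longrightarrow> g \<in> Hom C y z \<Longrightarrow>
      AMap \<phi> (g \<bullet>\<^bsub>C\<^esub> f) = AMap \<phi> g \<bullet>\<^bsub>D\<^esub> AMap \<phi> f"
    and gpd_map_ext: "OMap \<phi> \<in> extensional (Obj C)" "AMap \<phi> \<in> extensional (Arr C)"
proof -
  have *: "Src \<phi> = C" "Tgt \<phi> = D" "finite_groupoid C" "finite_groupoid D"
    "is_functor C D (OMap \<phi>) (AMap \<phi>)"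
    "OMap \<phi> \<in> extensional (Obj C)" "AMap \<phi> \<in> extensional (Arr C)"
    using assms by (auto simp: in_Hom_iff FinGpd_def)
  interpret is_functor C D "OMap \<phi>" "AMap \<phi>" by (rule *)
  show "Src \<phi> = C" "Tgt \<phi> = D" "finite_groupoid C" "finite_groupoid D"
    "x \<in> Obj C \<Longrightarrow> OMap \<phi> x \<in> Obj D"
    "f \<in> Hom C x y \<Longrightarrow> AMap \<phi> f \<in> Hom D (OMap \<phi> x) (OMap \<phi> y)"
    "x \<in> Obj C \<Longrightarrow> AMap \<phi> (Idn C x) = Idn D (OMap \<phi> x)"
    "f \<in> Hom C x y \<Longrightarrow> g \<in> Hom C y z \<Longrightarrow> AMap \<phi> (g \<bullet>\<^bsub>C\<^esub> f) = AMap \<phi> g \<bullet>\<^bsub>D\<^esub> AMap \<phi> f"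
    "OMap \<phi> \<in> extensional (Obj C)" "AMap \<phi> \<in> extensional (Arr C)"
    using * map_Obj map_Hom map_Idn map_Cmp by blast+
qed

lemma gpd_map_eqI:
  assumes "\<phi> \<in> Hom FinGpd C D" "\<psi> \<in> Hom FinGpd C D"
    and "\<And>x. x \<in> Obj C \<Longrightarrow> OMap \<phi> x = OMap \<psi> x"
    and "\<And>f. f \<in> Arr C \<Longrightarrow> AMap \<phi> f = AMap \<psi> f"
  shows "\<phi> = \<psi>"
proof (rule gpd_map.equality)
  show "OMap \<phi> = OMap \<psi>"
    using gpd_map_ext(1)[OF assms(1)] gpd_map_ext(1)[OF assms(2)] assms(3) by (rule extensionalityI)
  show "AMap \<phi> = AMap \<psi>"
    using gpd_map_ext(2)[OF assms(1)] gpd_map_ext(2)[OF assms(2)] assms(4) by (rule extensionalityI)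
qed (use assms(1,2) in \<open>simp_all add: gpd_map_Src gpd_map_Tgt\<close>)

lemma gpd_map_Cmp_in_Hom:
  assumes "\<phi> \<in> Hom FinGpd C D" "\<psi> \<in> Hom FinGpd D E"
  shows "\<psi> \<bullet>\<^bsub>FinGpd\<^esub> \<phi> \<in> Hom FinGpd C E"
proof -
  note p = assms(1) and q = assms(2)
  have "mk_map C E (\<lambda>x. OMap \<psi> (OMap \<phi> x)) (\<lambda>f. AMap \<psi> (AMap \<phi> f)) \<in> Hom FinGpd C E"
  proof (rule mk_map_in_Hom[OF gpd_map_finite_Src[OF p] gpd_map_finite_Tgt[OF q]])
    fix f g x y z assume f: "f \<in> Hom C x y" and g: "g \<in> Hom C y z"
    show "AMap \<psi> (AMap \<phi> (g \<bullet>\<^bsub>C\<^esub> f)) = AMap \<psi> (AMap \<phi> g) \<bullet>\<^bsub>E\<^esub> AMap \<psi> (AMap \<phi> f)"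
      by (simp add: gpd_map_Cmp[OF p f g]
          gpd_map_Cmp[OF q gpd_map_Arr[OF p f] gpd_map_Arr[OF p g]])
  qed (auto simp: gpd_map_Idn[OF p] gpd_map_Idn[OF q] gpd_map_Obj[OF p]
        intro: gpd_map_Obj[OF q] gpd_map_Arr[OF q] gpd_map_Arr[OF p] gpd_map_Obj[OF p])
  moreover have "mk_map C E (\<lambda>x. OMap \<psi> (OMap \<phi> x)) (\<lambda>f. AMap \<psi> (AMap \<phi> f)) = \<psi> \<bullet>\<^bsub>FinGpd\<^esub> \<phi>"
    using p q by (simp add: FinGpd_Cmp mk_map_def compose_def gpd_map_Src gpd_map_Tgt)
  ultimately show ?thesis by simp
qed

lemma Idn_in_Hom_FinGpd: "finite_groupoid C \<Longrightarrow> Idn FinGpd C \<in> Hom FinGpd C C"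
  using mk_map_in_Hom[of C C "\<lambda>x. x" "\<lambda>x. x"] by (simp add: mk_map_def)

text \<open>The target is a groupoid, which supplies the invertibility of the components.\<close>

lemma naturally_isomorphicI:
  assumes p: "\<phi> \<in> Hom FinGpd C D" and q: "\<psi> \<in> Hom FinGpd C D"
    and "\<And>x. x \<in> Obj C \<Longrightarrow> \<eta> x \<in> Hom D (OMap \<phi> x) (OMap \<psi> x)"
    and "\<And>x y f. f \<in> Hom C x y \<Longrightarrow> \<eta> y \<bullet>\<^bsub>D\<^esub> AMap \<phi> f = AMap \<psi> f \<bullet>\<^bsub>D\<^esub> \<eta> x"
  shows "naturally_isomorphic \<phi> \<psi>"
proof -
  interpret D: finite_gpd D using gpd_map_finite_Tgt[OF p] by (rule finite_gpdI)
  have "\<phi> \<in> Arr FinGpd" "\<psi> \<in> Arr FinGpd" using p q by (simp_all add: in_Hom_iff)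
  then show ?thesis
    unfolding naturally_isomorphic_def gpd_map_Src[OF p] gpd_map_Tgt[OF p] gpd_map_Src[OF q] gpd_map_Tgt[OF q]
    using assms(3,4) D.invertible by blast
qed

section \<open>Fully faithful maps and the criterion for an equivalence\<close>

definition fully_faithful :: "'u gpd_map \<Rightarrow> bool" where
  "fully_faithful \<phi> \<longleftrightarrow> (\<forall>x\<in>Obj (Src \<phi>). \<forall>y\<in>Obj (Src \<phi>).
     bij_betw (AMap \<phi>) (Hom (Src \<phi>) x y) (Hom (Tgt \<phi>) (OMap \<phi> x) (OMap \<phi> y)))"

lemma fully_faithful_inj:
  assumes "fully_faithful \<phi>" "\<phi> \<in> Hom FinGpd C D" "f \<in> Hom C x y" "g \<in> Hom C x y" "AMap \<phi> f = AMap \<phi> g"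
  shows "f = g"
proof -
  interpret C: finite_gpd C using gpd_map_finite_Src[OF assms(2)] by (rule finite_gpdI)
  show ?thesis using assms C.Hom_ends[OF assms(3)]
    by (auto simp: fully_faithful_def gpd_map_Src gpd_map_Tgt bij_betw_def dest: inj_onD)
qed

lemma fully_faithful_surj:
  assumes "fully_faithful \<phi>" "\<phi> \<in> Hom FinGpd C D" "x \<in> Obj C" "y \<in> Obj C" "g \<in> Hom D (OMap \<phi> x) (OMap \<phi> y)"
  obtains f where "f \<in> Hom C x y" "AMap \<phi> f = g"
proof -
  have "AMap \<phi> ` Hom C x y = Hom D (OMap \<phi> x) (OMap \<phi> y)"
    using assms by (auto simp: fully_faithful_def gpd_map_Src gpd_map_Tgt bij_betw_def)
  then show ?thesis using assms(5) that by (metis imageE)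
qed

lemma fully_faithfulI:
  assumes "\<phi> \<in> Hom FinGpd C D"
    and "\<And>x y f g. x \<in> Obj C \<Longrightarrow> y \<in> Obj C \<Longrightarrow> f \<in> Hom C x y \<Longrightarrow> g \<in> Hom C x y \<Longrightarrow> AMap \<phi> f = AMap \<phi> g \<Longrightarrow> f = g"
    and "\<And>x y g. x \<in> Obj C \<Longrightarrow> y \<in> Obj C \<Longrightarrow> g \<in> Hom D (OMap \<phi> x) (OMap \<phi> y) \<Longrightarrow> \<exists>f\<in>Hom C x y. AMap \<phi> f = g"
  shows "fully_faithful \<phi>"
  unfolding fully_faithful_def bij_betw_def gpd_map_Src[OF assms(1)] gpd_map_Tgt[OF assms(1)]
proof (intro ballI conjI inj_onI subset_antisym subsetI)
  fix x y g assume "x \<in> Obj C" "y \<in> Obj C" "g \<in> Hom D (OMap \<phi> x) (OMap \<phi> y)"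
  then show "g \<in> AMap \<phi> ` Hom C x y" using assms(3) by blast
qed (use assms(2) gpd_map_Arr[OF assms(1)] in blast)+

text \<open>A quasi-inverse sends d to a chosen object \<open>s d\<close> with an arrow
  \<open>e d\<close> from its image to d, and sends g to the unique lift of g conjugated by
  \<open>e\<close>. The arrows \<open>e\<close> form one of the two natural isomorphisms, and lifts
  of them along \<open>\<phi>\<close> form the other.\<close>

lemma gpd_equivalenceI:
  assumes p: "\<phi> \<in> Hom FinGpd C D" and ff: "fully_faithful \<phi>"
    and eso: "\<And>d. d \<in> Obj D \<Longrightarrow> \<exists>c\<in>Obj C. Hom D (OMap \<phi> c) d \<noteq> {}"
  shows "gpd_equivalence \<phi>"
proof -
  note fC = gpd_map_finite_Src[OF p] and fD = gpd_map_finite_Tgt[OF p]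
  interpret C: finite_gpd C using fC by (rule finite_gpdI)
  interpret D: finite_gpd D using fD by (rule finite_gpdI)
  have "\<forall>d. \<exists>c e. d \<in> Obj D \<longrightarrow> c \<in> Obj C \<and> e \<in> Hom D (OMap \<phi> c) d" using eso by blast
  then obtain s e where s: "\<And>d. d \<in> Obj D \<Longrightarrow> s d \<in> Obj C"
    and e: "\<And>d. d \<in> Obj D \<Longrightarrow> e d \<in> Hom D (OMap \<phi> (s d)) d" by metis
  have "\<forall>g. \<exists>f. g \<in> Arr D \<longrightarrow> f \<in> Hom C (s (Dom D g)) (s (Cod D g)) \<and>
      AMap \<phi> f = arr_inv D (e (Cod D g)) \<bullet>\<^bsub>D\<^esub> (g \<bullet>\<^bsub>D\<^esub> e (Dom D g))"
  proof
    fix g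
    show "\<exists>f. g \<in> Arr D \<longrightarrow> f \<in> Hom C (s (Dom D g)) (s (Cod D g)) \<and>
      AMap \<phi> f = arr_inv D (e (Cod D g)) \<bullet>\<^bsub>D\<^esub> (g \<bullet>\<^bsub>D\<^esub> e (Dom D g))"
    proof (cases "g \<in> Arr D")
      case True
      then have d: "Dom D g \<in> Obj D" "Cod D g \<in> Obj D" by (auto intro: D.Dom_closed D.Cod_closed)
      have "arr_inv D (e (Cod D g)) \<bullet>\<^bsub>D\<^esub> (g \<bullet>\<^bsub>D\<^esub> e (Dom D g))
          \<in> Hom D (OMap \<phi> (s (Dom D g))) (OMap \<phi> (s (Cod D g)))"
        by (meson D.Cmp_in_Hom D.arr_inv_in_Hom e d D.Arr_in_Hom True)
      then show ?thesis by (metis fully_faithful_surj[OF ff p s[OF d(1)] s[OF d(2)]])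
    qed simp
  qed
  then obtain t where t: "\<And>g. g \<in> Arr D \<Longrightarrow> t g \<in> Hom C (s (Dom D g)) (s (Cod D g))"
    and t_eq: "\<And>g. g \<in> Arr D \<Longrightarrow>
      AMap \<phi> (t g) = arr_inv D (e (Cod D g)) \<bullet>\<^bsub>D\<^esub> (g \<bullet>\<^bsub>D\<^esub> e (Dom D g))" by metis
  have t_Hom: "t g \<in> Hom C (s x) (s y)" if "g \<in> Hom D x y" for g x y
    using t[of g] that by (auto simp: in_Hom_iff)
  have t_nat: "e y \<bullet>\<^bsub>D\<^esub> AMap \<phi> (t g) = g \<bullet>\<^bsub>D\<^esub> e x" if g: "g \<in> Hom D x y" for g x y
  proof -
    have d: "x \<in> Obj D" "y \<in> Obj D" using D.Hom_ends[OF g] by auto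
    have "AMap \<phi> (t g) = arr_inv D (e y) \<bullet>\<^bsub>D\<^esub> (g \<bullet>\<^bsub>D\<^esub> e x)"
      using t_eq[of g] g by (simp add: in_Hom_iff)
    then show ?thesis using D.arr_inv_cancel(2)[OF e[OF d(2)] D.Cmp_in_Hom[OF e[OF d(1)] g]] by simp
  qed
  \<comment> \<open>Faithfulness makes the naturality square characterise \<open>t g\<close>. Both
    functor laws for \<open>t\<close> are then verified by checking that square, without calculating
    with inverses.\<close>
  have t_uniq: "f = t g" if f: "f \<in> Hom C (s x) (s y)" and g: "g \<in> Hom D x y"
    and eq: "e y \<bullet>\<^bsub>D\<^esub> AMap \<phi> f = g \<bullet>\<^bsub>D\<^esub> e x" for f g x y
  proof (rule fully_faithful_inj[OF ff p f t_Hom[OF g]])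
    have d: "x \<in> Obj D" "y \<in> Obj D" using D.Hom_ends[OF g] by auto
    show "AMap \<phi> f = AMap \<phi> (t g)"
      using D.Cmp_left_cancel[OF e[OF d(2)] gpd_map_Arr[OF p f] gpd_map_Arr[OF p t_Hom[OF g]]]
        eq t_nat[OF g] by simp
  qed
  define \<psi> where "\<psi> = mk_map D C s t"
  have q: "\<psi> \<in> Hom FinGpd D C" unfolding \<psi>_def
  proof (rule mk_map_in_Hom[OF fD fC s t_Hom])
    fix x assume x: "x \<in> Obj D"
    have "e x \<bullet>\<^bsub>D\<^esub> AMap \<phi> (Idn C (s x)) = Idn D x \<bullet>\<^bsub>D\<^esub> e x"
      using x by (simp add: gpd_map_Idn[OF p] s D.Cmp_Idn_right[OF e] D.Cmp_Idn_left[OF e])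
    then show "t (Idn D x) = Idn C (s x)"
      using t_uniq[OF C.Idn_in_Hom[OF s[OF x]] D.Idn_in_Hom[OF x]] by simp
  next
    fix f g x y z assume f: "f \<in> Hom D x y" and g: "g \<in> Hom D y z"
    have d: "x \<in> Obj D" "y \<in> Obj D" "z \<in> Obj D" using D.Hom_ends[OF f] D.Hom_ends[OF g] by auto
    note tf = t_Hom[OF f] and tg = t_Hom[OF g]
    note ptf = gpd_map_Arr[OF p tf] and ptg = gpd_map_Arr[OF p tg]
    have "e z \<bullet>\<^bsub>D\<^esub> AMap \<phi> (t g \<bullet>\<^bsub>C\<^esub> t f) = (g \<bullet>\<^bsub>D\<^esub> e y) \<bullet>\<^bsub>D\<^esub> AMap \<phi> (t f)"
      by (simp add: gpd_map_Cmp[OF p tf tg] D.Cmp_assoc[OF ptf ptg e[OF d(3)]] t_nat[OF g])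
    also have "\<dots> = g \<bullet>\<^bsub>D\<^esub> (f \<bullet>\<^bsub>D\<^esub> e x)"
      by (simp add: D.Cmp_assoc[OF ptf e[OF d(2)] g, symmetric] t_nat[OF f])
    also have "\<dots> = (g \<bullet>\<^bsub>D\<^esub> f) \<bullet>\<^bsub>D\<^esub> e x" by (rule D.Cmp_assoc[OF e[OF d(1)] f g])
    finally show "t (g \<bullet>\<^bsub>D\<^esub> f) = t g \<bullet>\<^bsub>C\<^esub> t f"
      using t_uniq[OF C.Cmp_in_Hom[OF tf tg] D.Cmp_in_Hom[OF f g]] by simp
  qed
  have \<psi>_simps: "Src \<psi> = D" "Tgt \<psi> = C" "\<And>x. x \<in> Obj D \<Longrightarrow> OMap \<psi> x = s x"
    "\<And>f. f \<in> Arr D \<Longrightarrow> AMap \<psi> f = t f" by (simp_all add: \<psi>_def)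
  have "naturally_isomorphic (\<phi> \<bullet>\<^bsub>FinGpd\<^esub> \<psi>) (Idn FinGpd D)"
  proof (rule naturally_isomorphicI[OF gpd_map_Cmp_in_Hom[OF q p] Idn_in_Hom_FinGpd[OF fD], where \<eta> = e])
    fix x assume "x \<in> Obj D"
    then show "e x \<in> Hom D (OMap (\<phi> \<bullet>\<^bsub>FinGpd\<^esub> \<psi>) x) (OMap (Idn FinGpd D) x)"
      using e by (simp add: \<psi>_simps)
  next
    fix x y f assume f: "f \<in> Hom D x y"
    then have "f \<in> Arr D" by (simp add: in_Hom_iff)
    then show "e y \<bullet>\<^bsub>D\<^esub> AMap (\<phi> \<bullet>\<^bsub>FinGpd\<^esub> \<psi>) f = AMap (Idn FinGpd D) f \<bullet>\<^bsub>D\<^esub> e x"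
      using t_nat[OF f] by (simp add: \<psi>_simps)
  qed
  moreover
  \<comment> \<open>At an object in the image of \<open>\<phi>\<close> the arrow \<open>e\<close>
    has a lift to C; the lifts are the components of the isomorphism on the source side.\<close>
  have "\<forall>c. \<exists>n. c \<in> Obj C \<longrightarrow> n \<in> Hom C (s (OMap \<phi> c)) c \<and> AMap \<phi> n = e (OMap \<phi> c)"
    using fully_faithful_surj[OF ff p s _ e] gpd_map_Obj[OF p] by (metis (full_types))
  then obtain n where n: "\<And>c. c \<in> Obj C \<Longrightarrow> n c \<in> Hom C (s (OMap \<phi> c)) c"
    and n_eq: "\<And>c. c \<in> Obj C \<Longrightarrow> AMap \<phi> (n c) = e (OMap \<phi> c)" by metis
  have "naturally_isomorphic (\<psi> \<bullet>\<^bsub>FinGpd\<^esub> \<phi>) (Idn FinGpd C)"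
  proof (rule naturally_isomorphicI[OF gpd_map_Cmp_in_Hom[OF p q] Idn_in_Hom_FinGpd[OF fC], where \<eta> = n])
    fix x assume "x \<in> Obj C"
    then show "n x \<in> Hom C (OMap (\<psi> \<bullet>\<^bsub>FinGpd\<^esub> \<phi>) x) (OMap (Idn FinGpd C) x)"
      using n by (simp add: \<psi>_simps gpd_map_Src[OF p] gpd_map_Obj[OF p])
  next
    fix x y f assume f: "f \<in> Hom C x y"
    have x: "x \<in> Obj C" "y \<in> Obj C" using C.Hom_ends[OF f] by auto
    note pf = gpd_map_Arr[OF p f]
    note tpf = t_Hom[OF pf]
    have "AMap \<phi> (n y \<bullet>\<^bsub>C\<^esub> t (AMap \<phi> f)) = AMap \<phi> (f \<bullet>\<^bsub>C\<^esub> n x)"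
      by (simp add: gpd_map_Cmp[OF p tpf n[OF x(2)]] gpd_map_Cmp[OF p n[OF x(1)] f]
          n_eq x t_nat[OF pf])
    then have "n y \<bullet>\<^bsub>C\<^esub> t (AMap \<phi> f) = f \<bullet>\<^bsub>C\<^esub> n x"
      using fully_faithful_inj[OF ff p C.Cmp_in_Hom[OF tpf n[OF x(2)]] C.Cmp_in_Hom[OF n[OF x(1)] f]]
      by simp
    moreover have "f \<in> Arr C" "AMap \<phi> f \<in> Arr D" using f pf by (simp_all add: in_Hom_iff)
    ultimately show "n y \<bullet>\<^bsub>C\<^esub> AMap (\<psi> \<bullet>\<^bsub>FinGpd\<^esub> \<phi>) f = AMap (Idn FinGpd C) f \<bullet>\<^bsub>C\<^esub> n x"
      by (simp add: \<psi>_simps gpd_map_Src[OF p])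
  qed
  ultimately show ?thesis
    unfolding gpd_equivalence_def gpd_map_Src[OF p] gpd_map_Tgt[OF p]
    using p q unfolding in_Hom_iff[of \<phi>] by blast
qed

section \<open>Fibered products\<close>

lemma finite_groupoidI:
  assumes "category C" "finite (Obj C)" "finite (Arr C)"
    and "\<And>f x y. f \<in> Hom C x y \<Longrightarrow> \<exists>g\<in>Hom C y x. g \<bullet>\<^bsub>C\<^esub> f = Idn C x \<and> f \<bullet>\<^bsub>C\<^esub> g = Idn C y"
  shows "finite_groupoid C"
  unfolding finite_groupoid_def invertible_arr_def mutually_inverse_def
  using assms(1-3) assms(4)[OF category.Arr_in_Hom[OF assms(1)]] by blast

text \<open>Fibered products live on a product type, but the Mackey axiom sees groupoids on
  \<open>'u\<close> only. Finite sets of objects and of arrows inject into the infinite type, and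
  the structure is carried over along two independent injections.\<close>

lemma ex_copy:
  fixes C :: "('o, 'm) cat"
  assumes "finite_groupoid C"
  obtains F :: "'u::infinite gpd" and T0 T1 where "finite_groupoid F" "is_functor F C T0 T1"
    "bij_betw T0 (Obj F) (Obj C)" "bij_betw T1 (Arr F) (Arr C)"
proof -
  interpret C: finite_gpd C using assms by (rule finite_gpdI)
  obtain i0 :: "'o \<Rightarrow> 'u" where i0: "inj_on i0 (Obj C)"
    using arb_inj_on_finite_infinite[OF C.finite_Obj] by blast
  obtain i1 :: "'m \<Rightarrow> 'u" where i1: "inj_on i1 (Arr C)"
    using arb_inj_on_finite_infinite[OF C.finite_Arr] by blast
  define T0 where "T0 = inv_into (Obj C) i0"
  define T1 where "T1 = inv_into (Arr C) i1"
  have T0: "T0 (i0 x) = x" if "x \<in> Obj C" for x using that i0 by (simp add: T0_def)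
  have T1: "T1 (i1 f) = f" if "f \<in> Arr C" for f using that i1 by (simp add: T1_def)
  define F where "F = \<lparr>Obj = i0 ` Obj C, Arr = i1 ` Arr C, Dom = \<lambda>f. i0 (Dom C (T1 f)),
    Cod = \<lambda>f. i0 (Cod C (T1 f)), Idn = \<lambda>x. i1 (Idn C (T0 x)),
    Cmp = \<lambda>g f. i1 (T1 g \<bullet>\<^bsub>C\<^esub> T1 f)\<rparr>"
  have Obj_F: "Obj F = i0 ` Obj C" and Arr_F: "Arr F = i1 ` Arr C" by (simp_all add: F_def)
  have Idn_F: "Idn F (i0 x) = i1 (Idn C x)" if "x \<in> Obj C" for x
    using that by (simp add: F_def T0)
  have Hom_F: "i1 f \<in> Hom F (i0 x) (i0 y)" if "f \<in> Hom C x y" for f x y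
    using that by (auto simp: F_def T1 in_Hom_iff)
  have Cmp_F: "i1 g \<bullet>\<^bsub>F\<^esub> i1 f = i1 (g \<bullet>\<^bsub>C\<^esub> f)" if "f \<in> Hom C x y" "g \<in> Hom C y z" for f g x y z
    using that by (simp add: F_def T1 in_Hom_iff)
  have HomE: "\<exists>f' x y. f = i1 f' \<and> X = i0 x \<and> Y = i0 y \<and> f' \<in> Hom C x y" if "f \<in> Hom F X Y" for f X Y
    using that by (auto simp: F_def T1 in_Hom_iff)
  have inj: "x = y" if "i0 x = i0 y" "x \<in> Obj C" "y \<in> Obj C" for x y
    using i0 that by (rule inj_onD)
  have cat: "category F"
  proof
    show "f \<in> Arr F \<Longrightarrow> Dom F f \<in> Obj F" "f \<in> Arr F \<Longrightarrow> Cod F f \<in> Obj F" for f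
      by (auto simp: F_def T1 C.Dom_closed C.Cod_closed)
  next
    fix X assume "X \<in> Obj F"
    then show "Idn F X \<in> Hom F X X" using Hom_F[OF C.Idn_in_Hom] by (auto simp: Obj_F Idn_F)
  next
    fix f X Y g Z assume "f \<in> Hom F X Y" "g \<in> Hom F Y Z"
    then obtain f' x y g' y' z where *: "f = i1 f'" "X = i0 x" "Y = i0 y" "f' \<in> Hom C x y"
      "g = i1 g'" "Y = i0 y'" "Z = i0 z" "g' \<in> Hom C y' z" by (metis HomE)
    \<comment> \<open>Composability in the copy says \<open>i0 y = i0 y'\<close>; injectivity on
      objects turns this into composability in C.\<close>
    have "y' = y" using * C.Hom_ends[of f'] C.Hom_ends[of g'] by (intro inj) auto
    then show "g \<bullet>\<^bsub>F\<^esub> f \<in> Hom F X Z"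
      using * by (auto simp: Cmp_F[of f' x y g' z] intro: Hom_F C.Cmp_in_Hom)
  next
    fix f X Y assume "f \<in> Hom F X Y"
    then obtain f' x y where *: "f = i1 f'" "X = i0 x" "Y = i0 y" "f' \<in> Hom C x y" by (metis HomE)
    then have d: "x \<in> Obj C" "y \<in> Obj C" using C.Hom_ends by auto
    show "Idn F Y \<bullet>\<^bsub>F\<^esub> f = f" "f \<bullet>\<^bsub>F\<^esub> Idn F X = f"
      using * by (simp_all add: Idn_F d Cmp_F[OF *(4) C.Idn_in_Hom[OF d(2)]] Cmp_F[OF C.Idn_in_Hom[OF d(1)] *(4)]
          C.Cmp_Idn_left[OF *(4)] C.Cmp_Idn_right[OF *(4)])
  next
    fix f W X g Y h Z assume "f \<in> Hom F W X" "g \<in> Hom F X Y" "h \<in> Hom F Y Z"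
    then obtain f' w x g' x' y h' y' z where *: "f = i1 f'" "W = i0 w" "X = i0 x" "f' \<in> Hom C w x"
      "g = i1 g'" "X = i0 x'" "Y = i0 y" "g' \<in> Hom C x' y"
      "h = i1 h'" "Y = i0 y'" "Z = i0 z" "h' \<in> Hom C y' z" by (metis HomE)
    have "x' = x" using * C.Hom_ends[of f'] C.Hom_ends[of g'] by (intro inj) auto
    moreover have "y' = y" using * C.Hom_ends[of g'] C.Hom_ends[of h'] by (intro inj) auto
    ultimately have g': "g' \<in> Hom C x y" and h': "h' \<in> Hom C y z" using * by auto
    show "h \<bullet>\<^bsub>F\<^esub> (g \<bullet>\<^bsub>F\<^esub> f) = (h \<bullet>\<^bsub>F\<^esub> g) \<bullet>\<^bsub>F\<^esub> f"
      using *(1,5,9) by (simp add: Cmp_F[OF *(4) g'] Cmp_F[OF g' h'] Cmp_F[OF C.Cmp_in_Hom[OF *(4) g'] h']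
          Cmp_F[OF *(4) C.Cmp_in_Hom[OF g' h']] C.Cmp_assoc[OF *(4) g' h'])
  qed
  have "finite_groupoid F"
  proof (rule finite_groupoidI[OF cat])
    show "finite (Obj F)" "finite (Arr F)" using C.finite_Obj C.finite_Arr by (simp_all add: Obj_F Arr_F)
    fix f X Y assume "f \<in> Hom F X Y"
    then obtain f' x y where *: "f = i1 f'" "X = i0 x" "Y = i0 y" "f' \<in> Hom C x y" by (metis HomE)
    then have d: "x \<in> Obj C" "y \<in> Obj C" using C.Hom_ends by auto
    note inv = C.arr_inv[OF *(4)]
    show "\<exists>g\<in>Hom F Y X. g \<bullet>\<^bsub>F\<^esub> f = Idn F X \<and> f \<bullet>\<^bsub>F\<^esub> g = Idn F Y"
      using *(1-3) Hom_F[OF inv(1)] inv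
      by (intro bexI[of _ "i1 (arr_inv C f')"])
        (simp_all add: Cmp_F[OF *(4) inv(1)] Cmp_F[OF inv(1) *(4)] Idn_F d)
  qed
  moreover have "is_functor F C T0 T1"
  proof (intro is_functor.intro is_functor_axioms.intro cat C.category_axioms)
    fix X assume "X \<in> Obj F"
    then show "T0 X \<in> Obj C" by (auto simp: Obj_F T0)
  next
    fix f X Y assume "f \<in> Hom F X Y"
    then show "T1 f \<in> Hom C (T0 X) (T0 Y)" using C.Hom_ends
      by (auto dest!: HomE simp: T0 T1 in_Hom_iff[of _ C] C.Dom_closed C.Cod_closed)
  next
    fix X assume "X \<in> Obj F"
    then show "T1 (Idn F X) = Idn C (T0 X)"
      using C.Idn_in_Hom by (auto simp: Obj_F T0 T1 Idn_F in_Hom_iff)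
  next
    fix f X Y g Z assume "f \<in> Hom F X Y" "g \<in> Hom F Y Z"
    then obtain f' x y g' y' z where *: "f = i1 f'" "X = i0 x" "Y = i0 y" "f' \<in> Hom C x y"
      "g = i1 g'" "Y = i0 y'" "Z = i0 z" "g' \<in> Hom C y' z" by (metis HomE)
    have "y' = y" using * C.Hom_ends[of f'] C.Hom_ends[of g'] by (intro inj) auto
    then have g': "g' \<in> Hom C y z" using * by simp
    show "T1 (g \<bullet>\<^bsub>F\<^esub> f) = T1 g \<bullet>\<^bsub>C\<^esub> T1 f"
      using *(1,5) *(4) g' C.Cmp_in_Hom[OF *(4) g']
      by (simp add: Cmp_F[OF *(4) g'] T1 in_Hom_iff[of _ C])
  qed
  moreover have "bij_betw T0 (Obj F) (Obj C)" "bij_betw T1 (Arr F) (Arr C)"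
    using i0 i1 by (simp_all add: Obj_F Arr_F T0_def T1_def bij_betw_inv_into inj_on_imp_bij_betw)
  ultimately show ?thesis using that by blast
qed

section \<open>The groupoid structure of the fibered product\<close>

lemma fibered_product_Obj: "(y, g, z) \<in> Obj (fibered_product \<delta> \<gamma>) \<longleftrightarrow>
    y \<in> Obj (Src \<delta>) \<and> z \<in> Obj (Src \<gamma>) \<and> g \<in> Hom (Tgt \<delta>) (OMap \<delta> y) (OMap \<gamma> z)"
  by (simp add: fibered_product_def Let_def)

lemma fibered_product_Hom: "(s, (k, h), t) \<in> Hom (fibered_product \<delta> \<gamma>) (y, g, z) (y', g', z') \<longleftrightarrow>
    s = (y, g, z) \<and> t = (y', g', z') \<and>
    (y, g, z) \<in> Obj (fibered_product \<delta> \<gamma>) \<and> (y', g', z') \<in> Obj (fibered_product \<delta> \<gamma>) \<and>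
    k \<in> Hom (Src \<delta>) y y' \<and> h \<in> Hom (Src \<gamma>) z z' \<and>
    g' \<bullet>\<^bsub>Tgt \<delta>\<^esub> AMap \<delta> k = AMap \<gamma> h \<bullet>\<^bsub>Tgt \<delta>\<^esub> g"
  by (auto simp: fibered_product_def Let_def in_Hom_iff)

lemma fibered_product_Cmp:
  "(s', (k', h'), t') \<bullet>\<^bsub>fibered_product \<delta> \<gamma>\<^esub> (s, (k, h), t)
     = (s, (k' \<bullet>\<^bsub>Src \<delta>\<^esub> k, h' \<bullet>\<^bsub>Src \<gamma>\<^esub> h), t')"
  by (simp add: fibered_product_def Let_def)

lemma fibered_product_Idn:
  "Idn (fibered_product \<delta> \<gamma>) (y, g, z) = ((y, g, z), (Idn (Src \<delta>) y, Idn (Src \<gamma>) z), (y, g, z))"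
  by (simp add: fibered_product_def Let_def)

lemma fibered_product_finite_groupoid:
  fixes \<delta> \<gamma> :: "'u gpd_map"
  assumes d: "\<delta> \<in> Hom FinGpd K G" and c: "\<gamma> \<in> Hom FinGpd H G"
  shows "finite_groupoid (fibered_product \<delta> \<gamma>)"
proof -
  interpret K: finite_gpd K using gpd_map_finite_Src[OF d] by (rule finite_gpdI)
  interpret H: finite_gpd H using gpd_map_finite_Src[OF c] by (rule finite_gpdI)
  interpret G: finite_gpd G using gpd_map_finite_Tgt[OF d] by (rule finite_gpdI)
  let ?P = "fibered_product \<delta> \<gamma>"
  note st = gpd_map_Src[OF d] gpd_map_Src[OF c] gpd_map_Tgt[OF d] gpd_map_Tgt[OF c]
  note ob = fibered_product_Obj[where \<delta>=\<delta> and \<gamma>=\<gamma>, unfolded st]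
  note hom = fibered_product_Hom[where \<delta>=\<delta> and \<gamma>=\<gamma>, unfolded st]
  note cmp = fibered_product_Cmp[where \<delta>=\<delta> and \<gamma>=\<gamma>, unfolded st]
  note idn = fibered_product_Idn[of \<delta> \<gamma>, unfolded st]
  have cmp_Hom: "v \<bullet>\<^bsub>?P\<^esub> u \<in> Hom ?P X Z" if u: "u \<in> Hom ?P X Y" and v: "v \<in> Hom ?P Y Z" for u v X Y Z
  proof -
    obtain s k h t s' k' h' t' y g z y' g' z' y'' g'' z'' where
      e: "u = (s, (k, h), t)" "v = (s', (k', h'), t')" "X = (y, g, z)" "Y = (y', g', z')" "Z = (y'', g'', z'')"
      by (metis surj_pair)
    from u v have k: "k \<in> Hom K y y'" "k' \<in> Hom K y' y''" and h: "h \<in> Hom H z z'" "h' \<in> Hom H z' z''"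
      and g: "g \<in> Hom G (OMap \<delta> y) (OMap \<gamma> z)" "g' \<in> Hom G (OMap \<delta> y') (OMap \<gamma> z')"
        "g'' \<in> Hom G (OMap \<delta> y'') (OMap \<gamma> z'')"
      and eq: "g' \<bullet>\<^bsub>G\<^esub> AMap \<delta> k = AMap \<gamma> h \<bullet>\<^bsub>G\<^esub> g" "g'' \<bullet>\<^bsub>G\<^esub> AMap \<delta> k' = AMap \<gamma> h' \<bullet>\<^bsub>G\<^esub> g'"
      by (simp_all add: e hom ob)
    note dk = gpd_map_Arr[OF d k(1)] gpd_map_Arr[OF d k(2)]
    note ch = gpd_map_Arr[OF c h(1)] gpd_map_Arr[OF c h(2)]
    \<comment> \<open>Compatibility of the composite: the two commuting squares are pasted along
      \<open>g'\<close>.\<close>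
    have "g'' \<bullet>\<^bsub>G\<^esub> AMap \<delta> (k' \<bullet>\<^bsub>K\<^esub> k) = (g'' \<bullet>\<^bsub>G\<^esub> AMap \<delta> k') \<bullet>\<^bsub>G\<^esub> AMap \<delta> k"
      by (simp add: gpd_map_Cmp[OF d k] G.Cmp_assoc[OF dk g(3)])
    also have "\<dots> = AMap \<gamma> h' \<bullet>\<^bsub>G\<^esub> (AMap \<gamma> h \<bullet>\<^bsub>G\<^esub> g)"
      by (simp add: eq(2) G.Cmp_assoc[OF dk(1) g(2) ch(2), symmetric] eq(1))
    also have "\<dots> = AMap \<gamma> (h' \<bullet>\<^bsub>H\<^esub> h) \<bullet>\<^bsub>G\<^esub> g"
      by (simp add: gpd_map_Cmp[OF c h] G.Cmp_assoc[OF g(1) ch])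
    finally show ?thesis using u v K.Cmp_in_Hom[OF k] H.Cmp_in_Hom[OF h] by (simp add: e cmp hom)
  qed
  have cat: "category ?P"
  proof
    show "f \<in> Arr ?P \<Longrightarrow> Dom ?P f \<in> Obj ?P" "f \<in> Arr ?P \<Longrightarrow> Cod ?P f \<in> Obj ?P" for f
      by (auto simp: fibered_product_def Let_def)
  next
    fix X assume X: "X \<in> Obj ?P"
    obtain y g z where e: "X = (y, g, z)" by (metis surj_pair)
    have "y \<in> Obj K" "z \<in> Obj H" "g \<in> Hom G (OMap \<delta> y) (OMap \<gamma> z)" using X by (simp_all add: e ob)
    then show "Idn ?P X \<in> Hom ?P X X" using X
      by (simp add: e idn hom K.Idn_in_Hom H.Idn_in_Hom gpd_map_Idn[OF d] gpd_map_Idn[OF c]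
          G.Cmp_Idn_left G.Cmp_Idn_right)
  next
    fix u X Y assume u: "u \<in> Hom ?P X Y"
    obtain s k h t y g z y' g' z' where e: "u = (s, (k, h), t)" "X = (y, g, z)" "Y = (y', g', z')"
      by (metis surj_pair)
    show "Idn ?P Y \<bullet>\<^bsub>?P\<^esub> u = u" "u \<bullet>\<^bsub>?P\<^esub> Idn ?P X = u"
      using u by (auto simp: e hom idn cmp K.Cmp_Idn_left H.Cmp_Idn_left K.Cmp_Idn_right H.Cmp_Idn_right)
  next
    fix u W X v Y w Z assume u: "u \<in> Hom ?P W X" and v: "v \<in> Hom ?P X Y" and w: "w \<in> Hom ?P Y Z"
    obtain s k h t s' k' h' t' s'' k'' h'' t'' where
      e: "u = (s, (k, h), t)" "v = (s', (k', h'), t')" "w = (s'', (k'', h''), t'')" by (metis surj_pair)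
    obtain y g z y' g' z' y'' g'' z'' y3 g3 z3 where
      e2: "W = (y, g, z)" "X = (y', g', z')" "Y = (y'', g'', z'')" "Z = (y3, g3, z3)" by (metis surj_pair)
    have "k \<in> Hom K y y'" "k' \<in> Hom K y' y''" "k'' \<in> Hom K y'' y3"
      "h \<in> Hom H z z'" "h' \<in> Hom H z' z''" "h'' \<in> Hom H z'' z3"
      using u v w by (simp_all add: e e2 hom)
    then show "w \<bullet>\<^bsub>?P\<^esub> (v \<bullet>\<^bsub>?P\<^esub> u) = (w \<bullet>\<^bsub>?P\<^esub> v) \<bullet>\<^bsub>?P\<^esub> u"
      using K.Cmp_assoc[of k y y' k' y'' k'' y3] H.Cmp_assoc[of h z z' h' z'' h'' z3] by (simp add: e cmp)
  qed (rule cmp_Hom)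
  have fin: "finite (Obj ?P)"
  proof (rule finite_subset)
    show "Obj ?P \<subseteq> Obj K \<times> Arr G \<times> Obj H" by (auto simp: ob in_Hom_iff)
  qed (simp add: K.finite_Obj G.finite_Arr H.finite_Obj)
  show ?thesis
  proof (rule finite_groupoidI[OF cat fin])
    have "Arr ?P \<subseteq> Obj ?P \<times> (Arr K \<times> Arr H) \<times> Obj ?P"
      by (auto simp: fibered_product_def Let_def in_Hom_iff st)
    then show "finite (Arr ?P)"
      by (rule finite_subset) (simp add: fin K.finite_Arr H.finite_Arr)
  next
    fix u X Y assume u: "u \<in> Hom ?P X Y"
    obtain s k h t y g z y' g' z' where e: "u = (s, (k, h), t)" "X = (y, g, z)" "Y = (y', g', z')"
      by (metis surj_pair)
    from u have k: "k \<in> Hom K y y'" and h: "h \<in> Hom H z z'"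
      and g: "g \<in> Hom G (OMap \<delta> y) (OMap \<gamma> z)" "g' \<in> Hom G (OMap \<delta> y') (OMap \<gamma> z')"
      and eq: "g' \<bullet>\<^bsub>G\<^esub> AMap \<delta> k = AMap \<gamma> h \<bullet>\<^bsub>G\<^esub> g"
      and o: "X \<in> Obj ?P" "Y \<in> Obj ?P" "s = X" "t = Y"
      by (simp_all add: e hom ob)
    note k' = K.arr_inv[OF k] and h' = H.arr_inv[OF h]
    have ob': "y \<in> Obj K" "y' \<in> Obj K" "z \<in> Obj H" "z' \<in> Obj H"
      using K.Hom_ends[OF k] H.Hom_ends[OF h] by auto
    note dk = gpd_map_Arr[OF d k] gpd_map_Arr[OF d k'(1)]
    note ch = gpd_map_Arr[OF c h] gpd_map_Arr[OF c h'(1)]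
    \<comment> \<open>The pair of inverses has to be compatible as an arrow from Y back to X. Both
      sides of that condition become \<open>g'\<close> after composition with
      \<open>AMap \<gamma> h\<close>, which can be cancelled.\<close>
    have "AMap \<gamma> h \<bullet>\<^bsub>G\<^esub> (g \<bullet>\<^bsub>G\<^esub> AMap \<delta> (arr_inv K k)) = g'"
      using ob' by (simp add: G.Cmp_assoc[OF dk(2) g(1) ch(1)] eq[symmetric]
          G.Cmp_assoc[OF dk(2) dk(1) g(2), symmetric] gpd_map_Cmp[OF d k'(1) k, symmetric] k'
          gpd_map_Idn[OF d] G.Cmp_Idn_right[OF g(2)])
    moreover have "AMap \<gamma> h \<bullet>\<^bsub>G\<^esub> (AMap \<gamma> (arr_inv H h) \<bullet>\<^bsub>G\<^esub> g') = g'"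
      using ob' by (simp add: G.Cmp_assoc[OF g(2) ch(2) ch(1)] gpd_map_Cmp[OF c h'(1) h, symmetric] h'
          gpd_map_Idn[OF c] G.Cmp_Idn_left[OF g(2)])
    ultimately have "g \<bullet>\<^bsub>G\<^esub> AMap \<delta> (arr_inv K k) = AMap \<gamma> (arr_inv H h) \<bullet>\<^bsub>G\<^esub> g'"
      using G.Cmp_left_cancel[OF ch(1) G.Cmp_in_Hom[OF dk(2) g(1)] G.Cmp_in_Hom[OF g(2) ch(2)]] by simp
    then show "\<exists>v\<in>Hom ?P Y X. v \<bullet>\<^bsub>?P\<^esub> u = Idn ?P X \<and> u \<bullet>\<^bsub>?P\<^esub> v = Idn ?P Y"
      using o k' h' by (intro bexI[of _ "(Y, (arr_inv K k, arr_inv H h), X)"]) (auto simp: e hom cmp idn)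
  qed
qed

text \<open>The fibered product in the form of a comma category, free of triples and of the chosen
  copy. \<open>c x\<close> is the middle entry of the triple behind x; every admissible triple comes
  from an object, and every compatible pair from exactly one arrow. \<open>fibered\<close> is kept
  alongside because the Mackey axiom is stated with it.\<close>

locale comma_square =
  fixes \<delta> \<gamma> \<alpha> \<beta> :: "'u gpd_map" and K H G F :: "'u gpd" and c :: "'u \<Rightarrow> 'u"
  assumes delta: "\<delta> \<in> Hom FinGpd K G" and gamma: "\<gamma> \<in> Hom FinGpd H G"
    and fibered: "is_fibered_product \<delta> \<gamma> F \<alpha> \<beta>"
    and compare: "x \<in> Obj F \<Longrightarrow> c x \<in> Hom G (OMap \<delta> (OMap \<beta> x)) (OMap \<gamma> (OMap \<alpha> x))"
    and compare_natural: "f \<in> Hom F x x' \<Longrightarrow>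
      c x' \<bullet>\<^bsub>G\<^esub> AMap \<delta> (AMap \<beta> f) = AMap \<gamma> (AMap \<alpha> f) \<bullet>\<^bsub>G\<^esub> c x"
    and ex_object: "y \<in> Obj K \<Longrightarrow> z \<in> Obj H \<Longrightarrow> g \<in> Hom G (OMap \<delta> y) (OMap \<gamma> z) \<Longrightarrow>
      \<exists>x\<in>Obj F. OMap \<beta> x = y \<and> OMap \<alpha> x = z \<and> c x = g"
    and ex_arrow: "x \<in> Obj F \<Longrightarrow> x' \<in> Obj F \<Longrightarrow> k \<in> Hom K (OMap \<beta> x) (OMap \<beta> x') \<Longrightarrow>
      h \<in> Hom H (OMap \<alpha> x) (OMap \<alpha> x') \<Longrightarrow> c x' \<bullet>\<^bsub>G\<^esub> AMap \<delta> k = AMap \<gamma> h \<bullet>\<^bsub>G\<^esub> c x \<Longrightarrow>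
      \<exists>f\<in>Hom F x x'. AMap \<beta> f = k \<and> AMap \<alpha> f = h"
    and arrow_unique: "f \<in> Hom F x x' \<Longrightarrow> f' \<in> Hom F x x' \<Longrightarrow> AMap \<beta> f = AMap \<beta> f' \<Longrightarrow>
      AMap \<alpha> f = AMap \<alpha> f' \<Longrightarrow> f = f'"
begin

lemma alpha: "\<alpha> \<in> Hom FinGpd F H" and beta: "\<beta> \<in> Hom FinGpd F K"
  using fibered delta gamma by (auto simp: is_fibered_product_def gpd_map_Src)

end

lemma ex_comma_square:
  fixes \<delta> \<gamma> :: "'u::infinite gpd_map"
  assumes d: "\<delta> \<in> Hom FinGpd K G" and c: "\<gamma> \<in> Hom FinGpd H G"
  obtains F \<alpha> \<beta> a where "comma_square \<delta> \<gamma> \<alpha> \<beta> K H G F a"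
proof -
  let ?P = "fibered_product \<delta> \<gamma>"
  obtain F :: "'u gpd" and T0 T1 where F: "finite_groupoid F" and T_functor: "is_functor F ?P T0 T1"
    and bij: "bij_betw T0 (Obj F) (Obj ?P)" "bij_betw T1 (Arr F) (Arr ?P)"
    using ex_copy[OF fibered_product_finite_groupoid[OF d c]] by blast
  interpret F: finite_gpd F using F by (rule finite_gpdI)
  interpret T: is_functor F ?P T0 T1 by (rule T_functor)
  note st = gpd_map_Src[OF d] gpd_map_Src[OF c] gpd_map_Tgt[OF d] gpd_map_Tgt[OF c]
  note ob = fibered_product_Obj[where \<delta>=\<delta> and \<gamma>=\<gamma>, unfolded st]
  note hom = fibered_product_Hom[where \<delta>=\<delta> and \<gamma>=\<gamma>, unfolded st]
  note cmp = fibered_product_Cmp[where \<delta>=\<delta> and \<gamma>=\<gamma>, unfolded st]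
  note idn = fibered_product_Idn[of \<delta> \<gamma>, unfolded st]
  define ky where "ky x = fst (T0 x)" for x
  define a where "a x = fst (snd (T0 x))" for x
  define hz where "hz x = snd (snd (T0 x))" for x
  define kk where "kk f = fst (fst (snd (T1 f)))" for f
  define hh where "hh f = snd (fst (snd (T1 f)))" for f
  have T0: "T0 x = (ky x, a x, hz x)" for x by (simp add: ky_def a_def hz_def)
  \<comment> \<open>Arrows of the fibered product carry their ends, and those of \<open>T1 f\<close>
    must be \<open>T0 x\<close> and \<open>T0 y\<close>; the only new information in
    \<open>T1 f\<close> is the middle pair.\<close>
  have T1: "T1 f = (T0 x, (kk f, hh f), T0 y)" if "f \<in> Hom F x y" for f x y
  proof -
    have "(fst (T1 f), (kk f, hh f), snd (snd (T1 f))) \<in> Hom ?P (T0 x) (T0 y)"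
      using T.map_Hom[OF that] by (simp add: kk_def hh_def)
    then have "fst (T1 f) = T0 x" "snd (snd (T1 f)) = T0 y" by (simp_all add: T0 hom)
    then show ?thesis by (simp add: kk_def hh_def prod_eq_iff)
  qed
  have obj: "ky x \<in> Obj K" "hz x \<in> Obj H" "a x \<in> Hom G (OMap \<delta> (ky x)) (OMap \<gamma> (hz x))"
    if "x \<in> Obj F" for x
    using T.map_Obj[OF that] by (simp_all add: T0 ob)
  have arr: "kk f \<in> Hom K (ky x) (ky y)" "hh f \<in> Hom H (hz x) (hz y)"
    "a y \<bullet>\<^bsub>G\<^esub> AMap \<delta> (kk f) = AMap \<gamma> (hh f) \<bullet>\<^bsub>G\<^esub> a x" if "f \<in> Hom F x y" for f x y
    using T.map_Hom[OF that] by (simp_all add: T1[OF that] T0 hom)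
  have kid: "kk (Idn F x) = Idn K (ky x)" "hh (Idn F x) = Idn H (hz x)" if "x \<in> Obj F" for x
    using T.map_Idn[OF that] T1[OF F.Idn_in_Hom[OF that]] by (simp_all add: T0 idn)
  have kcmp: "kk (g \<bullet>\<^bsub>F\<^esub> f) = kk g \<bullet>\<^bsub>K\<^esub> kk f" "hh (g \<bullet>\<^bsub>F\<^esub> f) = hh g \<bullet>\<^bsub>H\<^esub> hh f"
    if "f \<in> Hom F x y" "g \<in> Hom F y z" for f g x y z
    using T.map_Cmp[OF that] T1[OF F.Cmp_in_Hom[OF that]] T1[OF that(1)] T1[OF that(2)]
    by (simp_all add: cmp)
  define \<alpha> where "\<alpha> = mk_map F H hz hh"
  define \<beta> where "\<beta> = mk_map F K ky kk"
  have al: "\<alpha> \<in> Hom FinGpd F H" unfolding \<alpha>_def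
    by (rule mk_map_in_Hom[OF F gpd_map_finite_Src[OF c]]) (use obj arr kid kcmp in auto)
  have be: "\<beta> \<in> Hom FinGpd F K" unfolding \<beta>_def
    by (rule mk_map_in_Hom[OF F gpd_map_finite_Src[OF d]]) (use obj arr kid kcmp in auto)
  have ab [simp]: "\<And>x. x \<in> Obj F \<Longrightarrow> OMap \<alpha> x = hz x" "\<And>x. x \<in> Obj F \<Longrightarrow> OMap \<beta> x = ky x"
     "\<And>f. f \<in> Arr F \<Longrightarrow> AMap \<alpha> f = hh f" "\<And>f. f \<in> Arr F \<Longrightarrow> AMap \<beta> f = kk f"
    by (simp_all add: \<alpha>_def \<beta>_def)
  have "comma_square \<delta> \<gamma> \<alpha> \<beta> K H G F a"
  proof (intro comma_square.intro d c)
    have "\<forall>f\<in>Arr F. case T1 f of (s, (k, h), t) \<Rightarrow> AMap \<beta> f = k \<and> AMap \<alpha> f = h"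
      using T1[OF F.Arr_in_Hom] by simp
    moreover have "\<forall>x\<in>Obj F. case T0 x of (y, g, z) \<Rightarrow> OMap \<beta> x = y \<and> OMap \<alpha> x = z"
      by (simp add: T0)
    ultimately show "is_fibered_product \<delta> \<gamma> F \<alpha> \<beta>"
      unfolding is_fibered_product_def st using al be T_functor bij by blast
  next
    fix x assume "x \<in> Obj F"
    then show "a x \<in> Hom G (OMap \<delta> (OMap \<beta> x)) (OMap \<gamma> (OMap \<alpha> x))" using obj by simp
  next
    fix f x x' assume f: "f \<in> Hom F x x'"
    then have "f \<in> Arr F" by (simp add: in_Hom_iff)
    then show "a x' \<bullet>\<^bsub>G\<^esub> AMap \<delta> (AMap \<beta> f) = AMap \<gamma> (AMap \<alpha> f) \<bullet>\<^bsub>G\<^esub> a x" using arr(3)[OF f] by simp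
  next
    fix y z g assume "y \<in> Obj K" "z \<in> Obj H" "g \<in> Hom G (OMap \<delta> y) (OMap \<gamma> z)"
    then have "(y, g, z) \<in> Obj ?P" by (simp add: ob)
    then obtain x where "x \<in> Obj F" "T0 x = (y, g, z)"
      using bij(1) unfolding bij_betw_def by (metis imageE)
    then show "\<exists>x\<in>Obj F. OMap \<beta> x = y \<and> OMap \<alpha> x = z \<and> a x = g" by (auto simp: T0)
  next
    fix x x' k h assume x: "x \<in> Obj F" "x' \<in> Obj F" and kh: "k \<in> Hom K (OMap \<beta> x) (OMap \<beta> x')"
      "h \<in> Hom H (OMap \<alpha> x) (OMap \<alpha> x')" "a x' \<bullet>\<^bsub>G\<^esub> AMap \<delta> k = AMap \<gamma> h \<bullet>\<^bsub>G\<^esub> a x"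
    have "(T0 x, (k, h), T0 x') \<in> Hom ?P (T0 x) (T0 x')"
      using kh x T.map_Obj by (simp add: T0 hom)
    then have P: "(T0 x, (k, h), T0 x') \<in> Arr ?P" by (simp add: in_Hom_iff)
    then obtain f where f: "f \<in> Arr F" "T1 f = (T0 x, (k, h), T0 x')"
      using bij(2) unfolding bij_betw_def by (metis imageE)
    note T1f = T1[OF F.Arr_in_Hom[OF f(1)]]
    \<comment> \<open>The ends of \<open>T1 f\<close> are the images of the ends of f, and
      \<open>T0\<close> is injective on objects.\<close>
    have "Dom F f = x" "Cod F f = x'"
      using T1f f(2) x F.Dom_closed[OF f(1)] F.Cod_closed[OF f(1)] bij(1) 
      by (auto simp: bij_betw_def dest: inj_onD)
    then show "\<exists>f\<in>Hom F x x'. AMap \<beta> f = k \<and> AMap \<alpha> f = h"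
      using f T1f by (intro bexI[of _ f]) (auto simp: in_Hom_iff)
  next
    fix f x x' f' assume f: "f \<in> Hom F x x'" "f' \<in> Hom F x x'" "AMap \<beta> f = AMap \<beta> f'" "AMap \<alpha> f = AMap \<alpha> f'"
    then have "f \<in> Arr F" "f' \<in> Arr F" by (simp_all add: in_Hom_iff)
    moreover from this have "T1 f = T1 f'" using f by (simp add: T1)
    ultimately show "f = f'" using bij(2) by (auto simp: bij_betw_def dest: inj_onD)
  qed
  then show ?thesis by (rule that)
qed

section \<open>Full subgroupoids, vertex groups and finite groups as groupoids\<close>

definition full_sub :: "('o, 'm) cat \<Rightarrow> 'o set \<Rightarrow> ('o, 'm) cat" where
  "full_sub C S = C\<lparr>Obj := S, Arr := {f \<in> Arr C. Dom C f \<in> S \<and> Cod C f \<in> S}\<rparr>"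

definition full_incl :: "'u gpd \<Rightarrow> 'u set \<Rightarrow> 'u gpd_map" where
  "full_incl C S = mk_map (full_sub C S) C (\<lambda>x. x) (\<lambda>f. f)"

lemma full_sub_simps [simp]:
  "Obj (full_sub C S) = S" "Dom (full_sub C S) = Dom C" "Cod (full_sub C S) = Cod C"
  "Idn (full_sub C S) = Idn C" "Cmp (full_sub C S) = Cmp C"
  by (simp_all add: full_sub_def)

lemma full_sub_Hom: "f \<in> Hom (full_sub C S) x y \<longleftrightarrow> f \<in> Hom C x y \<and> x \<in> S \<and> y \<in> S"
  by (auto simp: full_sub_def in_Hom_iff)

lemma full_sub_finite_groupoid:
  assumes "finite_groupoid C" "S \<subseteq> Obj C"
  shows "finite_groupoid (full_sub C S)"
proof (rule finite_groupoidI)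
  interpret C: finite_gpd C using assms(1) by (rule finite_gpdI)
  show "finite (Obj (full_sub C S))" using assms(2) C.finite_Obj by (simp add: finite_subset)
  show "finite (Arr (full_sub C S))" using C.finite_Arr by (simp add: full_sub_def)
  show "category (full_sub C S)"
  proof
    fix f assume "f \<in> Arr (full_sub C S)"
    then show "Dom (full_sub C S) f \<in> Obj (full_sub C S)" "Cod (full_sub C S) f \<in> Obj (full_sub C S)"
      by (simp_all add: full_sub_def)
  next
    fix f W X g Y h Z
    assume "f \<in> Hom (full_sub C S) W X" "g \<in> Hom (full_sub C S) X Y" "h \<in> Hom (full_sub C S) Y Z"
    then show "h \<bullet>\<^bsub>full_sub C S\<^esub> (g \<bullet>\<^bsub>full_sub C S\<^esub> f) = (h \<bullet>\<^bsub>full_sub C S\<^esub> g) \<bullet>\<^bsub>full_sub C S\<^esub> f"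
      using C.Cmp_assoc[of f W X g Y h Z] by (simp add: full_sub_Hom)
  qed (use assms(2) in \<open>auto simp: full_sub_Hom C.Cmp_Idn_left C.Cmp_Idn_right C.Idn_in_Hom
      intro: C.Cmp_in_Hom\<close>)
  fix f x y assume "f \<in> Hom (full_sub C S) x y"
  then have f: "f \<in> Hom C x y" "x \<in> S" "y \<in> S" by (simp_all add: full_sub_Hom)
  show "\<exists>g\<in>Hom (full_sub C S) y x. g \<bullet>\<^bsub>full_sub C S\<^esub> f = Idn (full_sub C S) x \<and>
      f \<bullet>\<^bsub>full_sub C S\<^esub> g = Idn (full_sub C S) y"
    using C.arr_inv[OF f(1)] f(2,3) by (auto simp: full_sub_Hom)
qed

lemma full_incl_in_Hom:
  "finite_groupoid C \<Longrightarrow> S \<subseteq> Obj C \<Longrightarrow> full_incl C S \<in> Hom FinGpd (full_sub C S) C"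
  unfolding full_incl_def
  by (rule mk_map_in_Hom) (auto simp: full_sub_Hom full_sub_finite_groupoid)

lemma full_incl_simps [simp]:
  "Src (full_incl C S) = full_sub C S" "Tgt (full_incl C S) = C"
  "x \<in> S \<Longrightarrow> OMap (full_incl C S) x = x"
  "f \<in> Arr (full_sub C S) \<Longrightarrow> AMap (full_incl C S) f = f"
  by (simp_all add: full_incl_def)

text \<open>When no arrow joins S to its complement, every arrow lies in exactly one of the two full
  subgroupoids, so a pair of maps glues by a case distinction on the source of the arrow.\<close>

lemma full_incl_coproduct:
  assumes C: "finite_groupoid C" and S: "S \<subseteq> Obj C"
    and closed: "\<And>f. f \<in> Arr C \<Longrightarrow> Dom C f \<in> S \<longleftrightarrow> Cod C f \<in> S"
  shows "is_coproduct FinGpd (full_incl C S) (full_incl C (Obj C - S))"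
proof -
  interpret C: finite_gpd C using C by (rule finite_gpdI)
  let ?S' = "Obj C - S"
  have i: "full_incl C S \<in> Hom FinGpd (full_sub C S) C"
    and j: "full_incl C ?S' \<in> Hom FinGpd (full_sub C ?S') C"
    using full_incl_in_Hom[OF C] S by auto
  have Arr1: "Arr (full_sub C S) = {f \<in> Arr C. Dom C f \<in> S}"
    and Arr2: "Arr (full_sub C ?S') = {f \<in> Arr C. Dom C f \<notin> S}"
    using closed C.Dom_closed C.Cod_closed by (auto simp: full_sub_def)
  have Hom1: "f \<in> Hom (full_sub C S) x y" if "f \<in> Hom C x y" "x \<in> S" for f x y
    using that closed[of f] unfolding full_sub_Hom by (auto simp: in_Hom_iff)
  have Hom2: "f \<in> Hom (full_sub C ?S') x y" if "f \<in> Hom C x y" "x \<notin> S" for f x y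
    using that closed[of f] C.Hom_ends[of f x y] unfolding full_sub_Hom by (auto simp: in_Hom_iff)
  have "\<exists>!h. h \<in> Hom FinGpd C Y \<and> h \<bullet>\<^bsub>FinGpd\<^esub> full_incl C S = u \<and> h \<bullet>\<^bsub>FinGpd\<^esub> full_incl C ?S' = v"
    if u: "u \<in> Hom FinGpd (full_sub C S) Y" and v: "v \<in> Hom FinGpd (full_sub C ?S') Y" for u v Y
  proof (rule ex_ex1I)
    define h where "h = mk_map C Y (\<lambda>x. if x \<in> S then OMap u x else OMap v x)
      (\<lambda>f. if Dom C f \<in> S then AMap u f else AMap v f)"
    have h: "h \<in> Hom FinGpd C Y" unfolding h_def
    proof (rule mk_map_in_Hom[OF C gpd_map_finite_Tgt[OF u]])
      fix x assume x: "x \<in> Obj C"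
      show "(if x \<in> S then OMap u x else OMap v x) \<in> Obj Y"
        using x gpd_map_Obj[OF u] gpd_map_Obj[OF v] by simp
      have "Dom C (Idn C x) = x" using C.Idn_in_Hom[OF x] by (simp add: in_Hom_iff)
      then show "(if Dom C (Idn C x) \<in> S then AMap u (Idn C x) else AMap v (Idn C x)) =
          Idn Y (if x \<in> S then OMap u x else OMap v x)"
        using x gpd_map_Idn[OF u, of x] gpd_map_Idn[OF v, of x] by simp
    next
      fix f x y assume f: "f \<in> Hom C x y"
      then have "Dom C f = x" "x \<in> S \<longleftrightarrow> y \<in> S" using closed[of f] by (auto simp: in_Hom_iff)
      then show "(if Dom C f \<in> S then AMap u f else AMap v f) \<in>
          Hom Y (if x \<in> S then OMap u x else OMap v x) (if y \<in> S then OMap u y else OMap v y)"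
        using gpd_map_Arr[OF u Hom1[OF f]] gpd_map_Arr[OF v Hom2[OF f]] by simp
    next
      fix f g x y z assume f: "f \<in> Hom C x y" and g: "g \<in> Hom C y z"
      have "Dom C f = x" "x \<in> S \<longleftrightarrow> y \<in> S" "Dom C g = y" "Dom C (g \<bullet>\<^bsub>C\<^esub> f) = x"
        using f g closed[of f] C.Cmp_in_Hom[OF f g] by (auto simp: in_Hom_iff)
      then show "(if Dom C (g \<bullet>\<^bsub>C\<^esub> f) \<in> S then AMap u (g \<bullet>\<^bsub>C\<^esub> f) else AMap v (g \<bullet>\<^bsub>C\<^esub> f)) =
          (if Dom C g \<in> S then AMap u g else AMap v g) \<bullet>\<^bsub>Y\<^esub> (if Dom C f \<in> S then AMap u f else AMap v f)"
        using gpd_map_Cmp[OF u Hom1[OF f] Hom1[OF g]] gpd_map_Cmp[OF v Hom2[OF f] Hom2[OF g]] by simp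
    qed
    have "h \<bullet>\<^bsub>FinGpd\<^esub> full_incl C S = u"
      by (rule gpd_map_eqI[OF gpd_map_Cmp_in_Hom[OF i h] u]) (use S in \<open>auto simp: h_def Arr1\<close>)
    moreover have "h \<bullet>\<^bsub>FinGpd\<^esub> full_incl C ?S' = v"
      by (rule gpd_map_eqI[OF gpd_map_Cmp_in_Hom[OF j h] v]) (auto simp: h_def Arr2)
    ultimately show "\<exists>h. h \<in> Hom FinGpd C Y \<and> h \<bullet>\<^bsub>FinGpd\<^esub> full_incl C S = u \<and>
        h \<bullet>\<^bsub>FinGpd\<^esub> full_incl C ?S' = v"
      using h by blast
  next
    fix h h'
    assume *: "h \<in> Hom FinGpd C Y \<and> h \<bullet>\<^bsub>FinGpd\<^esub> full_incl C S = u \<and> h \<bullet>\<^bsub>FinGpd\<^esub> full_incl C ?S' = v"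
      "h' \<in> Hom FinGpd C Y \<and> h' \<bullet>\<^bsub>FinGpd\<^esub> full_incl C S = u \<and> h' \<bullet>\<^bsub>FinGpd\<^esub> full_incl C ?S' = v"
    \<comment> \<open>Uniqueness: the two restrictions determine k on objects, and likewise on
      arrows, by the formula that defined the glued map.\<close>
    have o: "OMap k x = (if x \<in> S then OMap u x else OMap v x)"
      if k: "k \<bullet>\<^bsub>FinGpd\<^esub> full_incl C S = u" "k \<bullet>\<^bsub>FinGpd\<^esub> full_incl C ?S' = v" and "x \<in> Obj C" for k x
      using that(3) unfolding k[symmetric] by simp
    have a: "AMap k f = (if Dom C f \<in> S then AMap u f else AMap v f)"
      if k: "k \<bullet>\<^bsub>FinGpd\<^esub> full_incl C S = u" "k \<bullet>\<^bsub>FinGpd\<^esub> full_incl C ?S' = v" and "f \<in> Arr C" for k f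
      using that(3) unfolding k[symmetric] by (simp add: Arr1 Arr2)
    show "h = h'" using * by (intro gpd_map_eqI[of h C Y h']) (auto simp: o a)
  qed
  moreover have "full_incl C S \<in> Arr FinGpd" "full_incl C ?S' \<in> Arr FinGpd"
    using i j by (simp_all add: in_Hom_iff)
  ultimately show ?thesis unfolding is_coproduct_def by simp
qed

section \<open>Finite groups as groupoids with one object\<close>

lemma gpd_of_simps [simp]:
  "Obj (gpd_of G) = {\<one>\<^bsub>G\<^esub>}" "Arr (gpd_of G) = carrier G" "Idn (gpd_of G) x = \<one>\<^bsub>G\<^esub>"
  "Cmp (gpd_of G) = mult G"
  by (simp_all add: gpd_of_def)

lemma gpd_of_Hom: "f \<in> Hom (gpd_of G) x y \<longleftrightarrow> f \<in> carrier G \<and> x = \<one>\<^bsub>G\<^esub> \<and> y = \<one>\<^bsub>G\<^esub>"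
  by (auto simp: gpd_of_def in_Hom_iff)

lemma gpd_of_finite_groupoid:
  assumes "finite_group G"
  shows "finite_groupoid (gpd_of G)"
proof (rule finite_groupoidI)
  interpret group G using assms by (simp add: finite_group_def)
  show "category (gpd_of G)"
    by unfold_locales (auto simp: gpd_of_Hom m_assoc, auto simp: gpd_of_def)
  show "finite (Obj (gpd_of G))" "finite (Arr (gpd_of G))" using assms by (simp_all add: finite_group_def)
  fix f x y assume "f \<in> Hom (gpd_of G) x y"
  then show "\<exists>g\<in>Hom (gpd_of G) y x. g \<bullet>\<^bsub>gpd_of G\<^esub> f = Idn (gpd_of G) x \<and> f \<bullet>\<^bsub>gpd_of G\<^esub> g = Idn (gpd_of G) y"
    by (intro bexI[of _ "inv\<^bsub>G\<^esub> f"]) (auto simp: gpd_of_Hom)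
qed

lemma gpd_map_of_eq_mk_map: "gpd_map_of G H \<phi> = mk_map (gpd_of G) (gpd_of H) (\<lambda>_. \<one>\<^bsub>H\<^esub>) \<phi>"
  by (simp add: gpd_map_of_def mk_map_def)

lemma gpd_map_of_simps [simp]:
  "Src (gpd_map_of G H \<phi>) = gpd_of G" "Tgt (gpd_map_of G H \<phi>) = gpd_of H"
  "OMap (gpd_map_of G H \<phi>) \<one>\<^bsub>G\<^esub> = \<one>\<^bsub>H\<^esub>" "g \<in> carrier G \<Longrightarrow> AMap (gpd_map_of G H \<phi>) g = \<phi> g"
  by (simp_all add: gpd_map_of_def)

lemma gpd_map_of_in_Hom:
  assumes G: "finite_group G" and H: "finite_group H" and \<phi>: "\<phi> \<in> hom G H"
  shows "gpd_map_of G H \<phi> \<in> Hom FinGpd (gpd_of G) (gpd_of H)"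
proof -
  interpret group_hom G H \<phi>
    using assms by (simp add: group_hom_def group_hom_axioms_def finite_group_def)
  show ?thesis unfolding gpd_map_of_eq_mk_map
    by (rule mk_map_in_Hom[OF gpd_of_finite_groupoid[OF G] gpd_of_finite_groupoid[OF H]])
      (auto simp: gpd_of_Hom)
qed

lemma gpd_map_of_Cmp:
  "\<beta> \<in> hom G H \<Longrightarrow> gpd_map_of H K \<alpha> \<bullet>\<^bsub>FinGpd\<^esub> gpd_map_of G H \<beta> = gpd_map_of G K (\<alpha> \<circ> \<beta>)"
  by (auto simp: FinGpd_Cmp gpd_map_of_def compose_def hom_def restrict_def Pi_iff fun_eq_iff)

lemma gpd_map_of_Idn: "gpd_map_of G G (\<lambda>g. g) = Idn FinGpd (gpd_of G)"
  by (auto simp: gpd_map_of_def restrict_def fun_eq_iff)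

lemma gpd_map_of_cong:
  "\<forall>g\<in>carrier G. \<phi> g = \<psi> g \<Longrightarrow> gpd_map_of G H \<phi> = gpd_map_of G H \<psi>"
  by (auto simp: gpd_map_of_def restrict_def fun_eq_iff)

section \<open>Vertex groups and their inclusions\<close>

definition vertex_group :: "'u gpd \<Rightarrow> 'u \<Rightarrow> 'u monoid" where
  "vertex_group C x = \<lparr>carrier = Hom C x x, mult = Cmp C, one = Idn C x\<rparr>"

text \<open>The single object of \<open>gpd_of (vertex_group C x)\<close> is named by the unit, that
  is by \<open>Idn C x\<close>; the inclusion sends this name to the object x.\<close>

definition vertex_incl :: "'u gpd \<Rightarrow> 'u \<Rightarrow> 'u gpd_map" where
  "vertex_incl C x = mk_map (gpd_of (vertex_group C x)) C (\<lambda>_. x) (\<lambda>f. f)"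

lemma vertex_group_simps [simp]:
  "carrier (vertex_group C x) = Hom C x x" "mult (vertex_group C x) = Cmp C"
  "\<one>\<^bsub>vertex_group C x\<^esub> = Idn C x"
  by (simp_all add: vertex_group_def)

lemma vertex_group_finite_group:
  assumes C: "finite_groupoid C" and x: "x \<in> Obj C"
  shows "finite_group (vertex_group C x)"
proof -
  interpret C: finite_gpd C using C by (rule finite_gpdI)
  have "group (vertex_group C x)"
  proof (rule groupI)
    fix f assume "f \<in> carrier (vertex_group C x)"
    then show "\<exists>g\<in>carrier (vertex_group C x). g \<otimes>\<^bsub>vertex_group C x\<^esub> f = \<one>\<^bsub>vertex_group C x\<^esub>"
      using C.arr_inv[of f x x] by auto
  qed (auto simp: x C.Idn_in_Hom C.Cmp_Idn_left C.Cmp_assoc intro: C.Cmp_in_Hom)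
  moreover have "finite (Hom C x x)" using C.finite_Arr by (simp add: Hom_def)
  ultimately show ?thesis by (simp add: finite_group_def)
qed

lemma vertex_incl_in_Hom:
  assumes C: "finite_groupoid C" and x: "x \<in> Obj C"
  shows "vertex_incl C x \<in> Hom FinGpd (gpd_of (vertex_group C x)) C"
  unfolding vertex_incl_def
  by (rule mk_map_in_Hom[OF gpd_of_finite_groupoid[OF vertex_group_finite_group[OF C x]] C])
    (auto simp: gpd_of_Hom x)

lemma vertex_incl_simps [simp]:
  "Src (vertex_incl C x) = gpd_of (vertex_group C x)" "Tgt (vertex_incl C x) = C"
  "OMap (vertex_incl C x) (Idn C x) = x" "f \<in> Hom C x x \<Longrightarrow> AMap (vertex_incl C x) f = f"
  by (simp_all add: vertex_incl_def)

lemma vertex_incl_fully_faithful: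
  "finite_groupoid C \<Longrightarrow> x \<in> Obj C \<Longrightarrow> fully_faithful (vertex_incl C x)"
  by (rule fully_faithfulI[OF vertex_incl_in_Hom]) (auto simp: gpd_of_Hom)

text \<open>A full subgroupoid has the same vertex groups, even as records. This makes the vertex
  inclusions of a part compatible with those of the whole, as an induction over components
  requires.\<close>

lemma full_incl_vertex_incl:
  assumes C: "finite_groupoid C" and S: "S \<subseteq> Obj C" and x: "x \<in> S"
  shows "full_incl C S \<bullet>\<^bsub>FinGpd\<^esub> vertex_incl (full_sub C S) x = vertex_incl C x"
proof -
  have Hom: "Hom (full_sub C S) x x = Hom C x x" using x by (auto simp: full_sub_Hom)
  then have vertex: "vertex_group (full_sub C S) x = vertex_group C x" by (simp add: vertex_group_def)
  have x': "x \<in> Obj C" "x \<in> Obj (full_sub C S)" using S x by auto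
  note v = vertex_incl_in_Hom[OF full_sub_finite_groupoid[OF C S] x'(2), unfolded vertex]
  have "Hom C x x \<subseteq> Arr (full_sub C S)" unfolding Hom[symmetric] by (auto simp: in_Hom_iff)
  then show ?thesis
    by (intro gpd_map_eqI[OF gpd_map_Cmp_in_Hom[OF v full_incl_in_Hom[OF C S]] vertex_incl_in_Hom[OF C x'(1)]])
      (use x in \<open>auto simp: vertex vertex_incl_def\<close>)
qed

section \<open>Decomposition of the identity\<close>

lemma hom_group_simps:
  "carrier (hom_group C X Y) = Hom C X Y" "mult (hom_group C X Y) = Add C"
  "\<one>\<^bsub>hom_group C X Y\<^esub> = Zero C X Y"
  by (simp_all add: hom_group_def)

context additive_category
begin

lemma Zero_in_Hom: "X \<in> Obj A \<Longrightarrow> Y \<in> Obj A \<Longrightarrow> Zero A X Y \<in> Hom A X Y"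
  using comm_group.axioms(1)[OF hom_comm_group, THEN comm_monoid.axioms(1), THEN monoid.one_closed]
  by (simp add: hom_group_simps)

lemma Cmp_Zero_right:
  assumes g: "g \<in> Hom A Y Z" and X: "X \<in> Obj A"
  shows "g \<bullet> Zero A X Y = Zero A X Z"
proof -
  have Y: "Y \<in> Obj A" "Z \<in> Obj A" using Hom_ends[OF g] by auto
  interpret XY: comm_group "hom_group A X Y" using X Y by (simp add: hom_comm_group)
  interpret XZ: comm_group "hom_group A X Z" using X Y by (simp add: hom_comm_group)
  note z = Zero_in_Hom[OF X Y(1)]
  have "Zero A X Y \<boxplus> Zero A X Y = Zero A X Y"
    using XY.r_one[OF XY.one_closed] by (simp add: hom_group_simps)
  then have "g \<bullet> Zero A X Y \<boxplus> g \<bullet> Zero A X Y = g \<bullet> Zero A X Y"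
    using Cmp_Add_right[OF z z g] by simp
  then show ?thesis
    using XZ.l_cancel_one[of "g \<bullet> Zero A X Y" "g \<bullet> Zero A X Y"] Cmp_in_Hom[OF z g]
    by (simp add: hom_group_simps)
qed

lemma Cmp_Zero_left:
  assumes f: "f \<in> Hom A X Y" and Z: "Z \<in> Obj A"
  shows "Zero A Y Z \<bullet> f = Zero A X Z"
proof -
  have X: "X \<in> Obj A" "Y \<in> Obj A" using Hom_ends[OF f] by auto
  interpret YZ: comm_group "hom_group A Y Z" using X Z by (simp add: hom_comm_group)
  interpret XZ: comm_group "hom_group A X Z" using X Z by (simp add: hom_comm_group)
  note z = Zero_in_Hom[OF X(2) Z]
  have "Zero A Y Z \<boxplus> Zero A Y Z = Zero A Y Z"
    using YZ.r_one[OF YZ.one_closed] by (simp add: hom_group_simps)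
  then have "Zero A Y Z \<bullet> f \<boxplus> Zero A Y Z \<bullet> f = Zero A Y Z \<bullet> f"
    using Cmp_Add_left[OF f z z] by simp
  then show ?thesis
    using XZ.l_cancel_one[of "Zero A Y Z \<bullet> f" "Zero A Y Z \<bullet> f"] Cmp_in_Hom[OF f z]
    by (simp add: hom_group_simps)
qed

text \<open>\<open>hom_group\<close> is written multiplicatively, so \<open>finprod\<close> is the
  finite sum of morphisms.\<close>

lemma finprod_in_Hom:
  assumes "X \<in> Obj A" "Y \<in> Obj A" "\<And>i. i \<in> I \<Longrightarrow> f i \<in> Hom A X Y"
  shows "finprod (hom_group A X Y) f I \<in> Hom A X Y"
proof -
  interpret comm_group "hom_group A X Y" using assms by (simp add: hom_comm_group)
  show ?thesis using finprod_closed[of f I] assms(3) by (auto simp: hom_group_simps Pi_iff)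
qed

lemma Cmp_finprod_right:
  assumes g: "g \<in> Hom A Y Z" and X: "X \<in> Obj A" and "finite I"
    and "\<And>i. i \<in> I \<Longrightarrow> f i \<in> Hom A X Y"
  shows "g \<bullet> finprod (hom_group A X Y) f I = finprod (hom_group A X Z) (\<lambda>i. g \<bullet> f i) I"
proof -
  have Y: "Y \<in> Obj A" "Z \<in> Obj A" using Hom_ends[OF g] by auto
  interpret XY: comm_group "hom_group A X Y" using X Y by (simp add: hom_comm_group)
  interpret XZ: comm_group "hom_group A X Z" using X Y by (simp add: hom_comm_group)
  show ?thesis using assms(3,4)
  proof induction
    case empty
    then show ?case by (simp add: hom_group_simps Cmp_Zero_right[OF g X])
  next
    case (insert i I)
    then have fI: "f i \<in> Hom A X Y" "finprod (hom_group A X Y) f I \<in> Hom A X Y" using X Y by (auto intro!: finprod_in_Hom)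
    moreover have "(\<lambda>i. g \<bullet> f i) \<in> I \<rightarrow> Hom A X Z" "g \<bullet> f i \<in> Hom A X Z"
      using insert.prems by (auto intro: Cmp_in_Hom[OF _ g])
    ultimately show ?case using insert
      by (simp add: XY.finprod_insert XZ.finprod_insert hom_group_simps Pi_iff Cmp_Add_right[OF fI g])
  qed
qed

lemma Cmp_finprod_left:
  assumes g: "g \<in> Hom A X Y" and Z: "Z \<in> Obj A" and "finite I"
    and "\<And>i. i \<in> I \<Longrightarrow> f i \<in> Hom A Y Z"
  shows "finprod (hom_group A Y Z) f I \<bullet> g = finprod (hom_group A X Z) (\<lambda>i. f i \<bullet> g) I"
proof -
  have X: "X \<in> Obj A" "Y \<in> Obj A" using Hom_ends[OF g] by auto
  interpret YZ: comm_group "hom_group A Y Z" using X Z by (simp add: hom_comm_group)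
  interpret XZ: comm_group "hom_group A X Z" using X Z by (simp add: hom_comm_group)
  show ?thesis using assms(3,4)
  proof induction
    case empty
    then show ?case by (simp add: hom_group_simps Cmp_Zero_left[OF g Z])
  next
    case (insert i I)
    then have fI: "f i \<in> Hom A Y Z" "finprod (hom_group A Y Z) f I \<in> Hom A Y Z" using X Z by (auto intro!: finprod_in_Hom)
    moreover have "(\<lambda>i. f i \<bullet> g) \<in> I \<rightarrow> Hom A X Z" "f i \<bullet> g \<in> Hom A X Z"
      using insert.prems by (auto intro: Cmp_in_Hom[OF g])
    ultimately show ?case using insert
      by (simp add: YZ.finprod_insert XZ.finprod_insert hom_group_simps Pi_iff Cmp_Add_left[OF g fI])
  qed
qed

end

section \<open>Functoriality of push and pull\<close>

lemma opposite_simps [simp]: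
  "Obj (opposite C) = Obj C" "Hom (opposite C) X Y = Hom C Y X" "Idn (opposite C) = Idn C"
  "g \<bullet>\<^bsub>opposite C\<^esub> f = f \<bullet>\<^bsub>C\<^esub> g"
  by (auto simp: opposite_def Hom_def)

locale additive_mackey_functor = additive_category A + globally_defined_mackey_functor A M push pull
  for A :: "('o, 'm, 'z) additive_cat_scheme" (structure)
    and M :: "'u::infinite gpd \<Rightarrow> 'o" and push pull :: "'u gpd_map \<Rightarrow> 'm"
begin

lemma M_Obj: "finite_groupoid C \<Longrightarrow> M C \<in> Obj A"
  using is_functor.map_Obj[OF push_functor, of C] by simp

lemma push_in_Hom: "\<phi> \<in> Hom FinGpd C D \<Longrightarrow> push \<phi> \<in> Hom A (M C) (M D)"
  by (rule is_functor.map_Hom[OF push_functor])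

lemma pull_in_Hom: "\<phi> \<in> Hom FinGpd C D \<Longrightarrow> pull \<phi> \<in> Hom A (M D) (M C)"
  using is_functor.map_Hom[OF pull_functor, of \<phi> D C] by simp

lemma push_Cmp: "\<phi> \<in> Hom FinGpd C D \<Longrightarrow> \<psi> \<in> Hom FinGpd D E \<Longrightarrow>
    push (\<psi> \<bullet>\<^bsub>FinGpd\<^esub> \<phi>) = push \<psi> \<bullet> push \<phi>"
  by (rule is_functor.map_Cmp[OF push_functor])

lemma pull_Cmp: "\<phi> \<in> Hom FinGpd C D \<Longrightarrow> \<psi> \<in> Hom FinGpd D E \<Longrightarrow>
    pull (\<psi> \<bullet>\<^bsub>FinGpd\<^esub> \<phi>) = pull \<phi> \<bullet> pull \<psi>"
  using is_functor.map_Cmp[OF pull_functor, of \<psi> E D \<phi> C] by simp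

lemma push_Idn: "finite_groupoid C \<Longrightarrow> push (Idn FinGpd C) = Idn A (M C)"
  by (rule is_functor.map_Idn[OF push_functor]) simp

lemma pull_Idn: "finite_groupoid C \<Longrightarrow> pull (Idn FinGpd C) = Idn A (M C)"
  using is_functor.map_Idn[OF pull_functor, of C] by (simp del: FinGpd_simps(4))

section \<open>Composites of push and pull, and the decomposition they yield\<close>

lemma push_pull_equivalence:
  assumes "\<phi> \<in> Hom FinGpd C D" "gpd_equivalence \<phi>"
  shows "push \<phi> \<bullet> pull \<phi> = Idn A (M D)"
  using equivalences[OF assms(2)] push_in_Hom[OF assms(1)]
  by (simp add: mutually_inverse_def in_Hom_iff)

text \<open>In the fibered product of i with itself, full faithfulness makes the projection
  \<open>\<alpha>\<close> an equivalence, and the comparison arrows lift along i to a natural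
  isomorphism from \<open>\<beta>\<close> to \<open>\<alpha>\<close>. So the composite equals
  \<open>push \<alpha> \<bullet> pull \<alpha>\<close>, which is the identity.\<close>

lemma pull_push_fully_faithful:
  assumes i: "i \<in> Hom FinGpd C D" and ff: "fully_faithful i"
  shows "pull i \<bullet> push i = Idn A (M C)"
proof -
  obtain F \<alpha> \<beta> c where "comma_square i i \<alpha> \<beta> C C D F c" using ex_comma_square[OF i i] .
  then interpret S: comma_square i i \<alpha> \<beta> C C D F c .
  interpret C: finite_gpd C using gpd_map_finite_Src[OF i] by (rule finite_gpdI)
  interpret D: finite_gpd D using gpd_map_finite_Tgt[OF i] by (rule finite_gpdI)
  interpret F: finite_gpd F using gpd_map_finite_Src[OF S.alpha] by (rule finite_gpdI)
  note al = S.alpha and be = S.beta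
  have "fully_faithful \<alpha>"
  proof (rule fully_faithfulI[OF al])
    fix x y f g assume f: "f \<in> Hom F x y" and g: "g \<in> Hom F x y" and eq: "AMap \<alpha> f = AMap \<alpha> g"
    have "y \<in> Obj F" using F.Hom_ends[OF f] by simp
    \<comment> \<open>By naturality, equal images under \<open>\<alpha>\<close> give equal
      composites with \<open>c y\<close>; cancelling \<open>c y\<close> reduces the claim to
      faithfulness of i.\<close>
    have "AMap i (AMap \<beta> f) = AMap i (AMap \<beta> g)"
      using D.Cmp_left_cancel[OF S.compare[OF \<open>y \<in> Obj F\<close>] gpd_map_Arr[OF i gpd_map_Arr[OF be f]]
          gpd_map_Arr[OF i gpd_map_Arr[OF be g]]] S.compare_natural[OF f] S.compare_natural[OF g] eq
      by simp
    then have "AMap \<beta> f = AMap \<beta> g"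
      by (rule fully_faithful_inj[OF ff i gpd_map_Arr[OF be f] gpd_map_Arr[OF be g]])
    then show "f = g" using S.arrow_unique[OF f g] eq by simp
  next
    fix x y h assume x: "x \<in> Obj F" and y: "y \<in> Obj F" and h: "h \<in> Hom C (OMap \<alpha> x) (OMap \<alpha> y)"
    note ih = gpd_map_Arr[OF i h] and cx = S.compare[OF x] and cy = S.compare[OF y]
    have r: "AMap i h \<bullet>\<^bsub>D\<^esub> c x \<in> Hom D (OMap i (OMap \<beta> x)) (OMap i (OMap \<alpha> y))"
      by (rule D.Cmp_in_Hom[OF cx ih])
    \<comment> \<open>Solving the compatibility condition for the image of k under i gives the arrow
      that has to be lifted.\<close>
    obtain k where k: "k \<in> Hom C (OMap \<beta> x) (OMap \<beta> y)" "AMap i k = arr_inv D (c y) \<bullet>\<^bsub>D\<^esub> (AMap i h \<bullet>\<^bsub>D\<^esub> c x)"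
      using fully_faithful_surj[OF ff i gpd_map_Obj[OF be x] gpd_map_Obj[OF be y]
          D.Cmp_in_Hom[OF r D.arr_inv_in_Hom[OF cy]]] .
    have "c y \<bullet>\<^bsub>D\<^esub> AMap i k = AMap i h \<bullet>\<^bsub>D\<^esub> c x"
      unfolding k(2) by (rule D.arr_inv_cancel(2)[OF cy r])
    then show "\<exists>f\<in>Hom F x y. AMap \<alpha> f = h" using S.ex_arrow[OF x y k(1) h] by blast
  qed
  moreover have "\<exists>x\<in>Obj F. Hom C (OMap \<alpha> x) z \<noteq> {}" if z: "z \<in> Obj C" for z
  proof -
    obtain x where "x \<in> Obj F" "OMap \<alpha> x = z"
      using S.ex_object[OF z z D.Idn_in_Hom[OF gpd_map_Obj[OF i z]]] by auto
    then show ?thesis using C.Idn_in_Hom[OF z] by auto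
  qed
  ultimately have eqv: "gpd_equivalence \<alpha>" by (intro gpd_equivalenceI[OF al])
  have "\<forall>x. \<exists>n. x \<in> Obj F \<longrightarrow> n \<in> Hom C (OMap \<beta> x) (OMap \<alpha> x) \<and> AMap i n = c x"
    using fully_faithful_surj[OF ff i gpd_map_Obj[OF be] gpd_map_Obj[OF al] S.compare]
    by (metis (full_types))
  then obtain n where n: "\<And>x. x \<in> Obj F \<Longrightarrow> n x \<in> Hom C (OMap \<beta> x) (OMap \<alpha> x)"
    and n_eq: "\<And>x. x \<in> Obj F \<Longrightarrow> AMap i (n x) = c x" by metis
  have "naturally_isomorphic \<beta> \<alpha>"
  proof (rule naturally_isomorphicI[OF be al n])
    fix x y f assume f: "f \<in> Hom F x y"
    then have o: "x \<in> Obj F" "y \<in> Obj F" using F.Hom_ends by auto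
    note bf = gpd_map_Arr[OF be f] and af = gpd_map_Arr[OF al f]
    have "AMap i (n y \<bullet>\<^bsub>C\<^esub> AMap \<beta> f) = AMap i (AMap \<alpha> f \<bullet>\<^bsub>C\<^esub> n x)"
      by (simp add: gpd_map_Cmp[OF i bf n[OF o(2)]] gpd_map_Cmp[OF i n[OF o(1)] af] n_eq o
          S.compare_natural[OF f])
    then show "n y \<bullet>\<^bsub>C\<^esub> AMap \<beta> f = AMap \<alpha> f \<bullet>\<^bsub>C\<^esub> n x"
      by (rule fully_faithful_inj[OF ff i C.Cmp_in_Hom[OF bf n[OF o(2)]] C.Cmp_in_Hom[OF n[OF o(1)] af]])
  qed
  then have "push \<beta> = push \<alpha>" using natural_isomorphisms by blast
  then show ?thesis
    using fibered_products[OF i i S.fibered] push_pull_equivalence[OF al eqv] by simp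
qed

text \<open>An object of the fibered product would supply an arrow between the two images. So F is
  empty, and the composite factors through the zero object \<open>M F\<close>.\<close>

lemma pull_push_disjoint:
  assumes i: "i \<in> Hom FinGpd C D" and j: "j \<in> Hom FinGpd C' D"
    and disjoint: "\<And>x y. x \<in> Obj C \<Longrightarrow> y \<in> Obj C' \<Longrightarrow> Hom D (OMap j y) (OMap i x) = {}"
  shows "pull j \<bullet> push i = Zero A (M C) (M C')"
proof -
  obtain F \<alpha> \<beta> c where "comma_square j i \<alpha> \<beta> C' C D F c" using ex_comma_square[OF j i] .
  then interpret S: comma_square j i \<alpha> \<beta> C' C D F c .
  note fF = gpd_map_finite_Src[OF S.alpha]
  have MC: "M C \<in> Obj A" "M F \<in> Obj A" using gpd_map_finite_Src[OF i] fF by (simp_all add: M_Obj)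
  have "Obj F = {}"
    using S.compare disjoint gpd_map_Obj[OF S.alpha] gpd_map_Obj[OF S.beta] by blast
  then have "zero_object A (M F)" by (rule empty_groupoid[OF fF])
  then have "pull \<alpha> = Zero A (M C) (M F)"
    using pull_in_Hom[OF S.alpha] Zero_in_Hom[OF MC] MC(1) unfolding zero_object_def by blast
  then show ?thesis
    using fibered_products[OF j i S.fibered] Cmp_Zero_right[OF push_in_Hom[OF S.beta] MC(1)] by simp
qed

text \<open>Induction over the chosen points: C is the coproduct of the component S of
  \<open>p j\<close> and its complement. On S the vertex inclusion is an equivalence, so its
  \<open>push\<close> can be cancelled on the right; the complement is covered by the remaining
  points. The conditions on C stand in the conclusion because the induction hypothesis is applied to
  that complement instead of C.\<close>

lemma vertex_incl_jointly_epi: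
  assumes "finite I"
  shows "finite_groupoid C \<Longrightarrow> (\<And>i. i \<in> I \<Longrightarrow> p i \<in> Obj C) \<Longrightarrow>
    (\<And>x. x \<in> Obj C \<Longrightarrow> \<exists>!i. i \<in> I \<and> Hom C (p i) x \<noteq> {}) \<Longrightarrow>
    h \<in> Hom A (M C) X \<Longrightarrow> h' \<in> Hom A (M C) X \<Longrightarrow>
    (\<And>i. i \<in> I \<Longrightarrow> h \<bullet> push (vertex_incl C (p i)) = h' \<bullet> push (vertex_incl C (p i))) \<Longrightarrow> h = h'"
  using assms
proof (induction I arbitrary: C h h')
  case empty
  \<comment> \<open>Without indices there are no objects, so \<open>M C\<close> is a zero object and
    has only one arrow to X.\<close>
  then have "Obj C = {}" by auto
  then have "zero_object A (M C)" by (rule empty_groupoid[OF empty.prems(1)])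
  then show ?case using empty.prems(4,5) Hom_ends[of h] unfolding zero_object_def by blast
next
  case (insert j I)
  note C = insert.prems(1) and h = insert.prems(4) and h' = insert.prems(5)
  interpret C: finite_gpd C using C by (rule finite_gpdI)
  have MC: "M C \<in> Obj A" "X \<in> Obj A" using Hom_ends[OF h] by auto
  define S where "S = {x \<in> Obj C. Hom C (p j) x \<noteq> {}}"
  have S: "S \<subseteq> Obj C" "Obj C - S \<subseteq> Obj C" by (auto simp: S_def)
  note i1 = full_incl_in_Hom[OF C S(1)] and i2 = full_incl_in_Hom[OF C S(2)]
  note f1 = full_sub_finite_groupoid[OF C S(1)] and f2 = full_sub_finite_groupoid[OF C S(2)]
  \<comment> \<open>An arrow from \<open>p j\<close> to one end of f is carried to the other end by
    f or by its inverse.\<close>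
  have closed: "Dom C f \<in> S \<longleftrightarrow> Cod C f \<in> S" if "f \<in> Arr C" for f
  proof -
    note f = C.Arr_in_Hom[OF that]
    show ?thesis using C.Hom_ends[OF f] C.Cmp_in_Hom[OF _ f] C.Cmp_in_Hom[OF _ C.arr_inv_in_Hom[OF f]]
      by (fastforce simp: S_def)
  qed
  have pj: "p j \<in> Obj C" "p j \<in> S" using insert.prems(2)[of j] C.Idn_in_Hom[of "p j"] by (auto simp: S_def)
  have coprod: "is_coproduct A (push (full_incl C S)) (push (full_incl C (Obj C - S)))"
    by (rule coproducts[OF full_incl_coproduct[OF C S(1) closed]])
  have eq1: "h \<bullet> push (full_incl C S) = h' \<bullet> push (full_incl C S)"
  proof -
    let ?e = "vertex_incl (full_sub C S) (p j)"
    have e: "?e \<in> Hom FinGpd (gpd_of (vertex_group (full_sub C S) (p j))) (full_sub C S)"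
      using pj by (intro vertex_incl_in_Hom[OF f1]) simp
    have "gpd_equivalence ?e"
    proof (rule gpd_equivalenceI[OF e])
      show "fully_faithful ?e" using pj by (intro vertex_incl_fully_faithful[OF f1]) simp
      fix d assume "d \<in> Obj (full_sub C S)"
      moreover from this have "Hom (full_sub C S) (p j) d = Hom C (p j) d" using pj by (auto simp: full_sub_Hom)
      ultimately show "\<exists>c\<in>Obj (gpd_of (vertex_group (full_sub C S) (p j))). Hom (full_sub C S) (OMap ?e c) d \<noteq> {}"
        by (auto simp: vertex_incl_def S_def)
    qed
    then have id: "push ?e \<bullet> pull ?e = Idn A (M (full_sub C S))" by (rule push_pull_equivalence[OF e])
    have v: "push (full_incl C S) \<bullet> push ?e = push (vertex_incl C (p j))"
      using push_Cmp[OF e i1] full_incl_vertex_incl[OF C S(1) pj(2)] by simp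
    \<comment> \<open>Inserting \<open>push ?e \<bullet> pull ?e\<close>, an identity, expresses k
      on S through its composite with the inclusion of the single vertex \<open>p j\<close>.\<close>
    have key: "k \<bullet> push (full_incl C S) = (k \<bullet> push (vertex_incl C (p j))) \<bullet> pull ?e" if k: "k \<in> Hom A (M C) X" for k
    proof -
      note pe = push_in_Hom[OF e] and le = pull_in_Hom[OF e] and pi = push_in_Hom[OF i1]
      note ki = Cmp_in_Hom[OF pi k]
      have "k \<bullet> push (full_incl C S) = (k \<bullet> push (full_incl C S)) \<bullet> (push ?e \<bullet> pull ?e)"
        unfolding id by (simp add: Cmp_Idn_right[OF ki])
      also have "\<dots> = ((k \<bullet> push (full_incl C S)) \<bullet> push ?e) \<bullet> pull ?e" by (rule Cmp_assoc[OF le pe ki])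
      also have "(k \<bullet> push (full_incl C S)) \<bullet> push ?e = k \<bullet> push (vertex_incl C (p j))"
        unfolding v[symmetric] by (rule Cmp_assoc[OF pe pi k, symmetric])
      finally show ?thesis .
    qed
    show ?thesis using key[OF h] key[OF h'] insert.prems(6)[of j] by simp
  qed
  have eq2: "h \<bullet> push (full_incl C (Obj C - S)) = h' \<bullet> push (full_incl C (Obj C - S))"
  proof (rule insert.IH[OF f2])
    show pi: "p i \<in> Obj (full_sub C (Obj C - S))" if "i \<in> I" for i
    proof -
      have o: "p i \<in> Obj C" using insert.prems(2) that by simp
      then show ?thesis
        using insert.prems(3)[OF o] C.Idn_in_Hom[OF o] that insert.hyps(2) by (auto simp: S_def)
    qed
    show "\<exists>!i. i \<in> I \<and> Hom (full_sub C (Obj C - S)) (p i) x \<noteq> {}" if "x \<in> Obj (full_sub C (Obj C - S))" for x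
    proof -
      have x: "x \<in> Obj C" "x \<notin> S" using that by auto
      have "Hom (full_sub C (Obj C - S)) (p i) x = Hom C (p i) x" if "i \<in> I" for i
        using pi[OF that] x by (auto simp: full_sub_Hom)
      moreover have "Hom C (p j) x = {}" using x by (simp add: S_def)
      ultimately show ?thesis using insert.prems(3)[OF x(1)] by (metis insert_iff)
    qed
    show "h \<bullet> push (full_incl C (Obj C - S)) \<in> Hom A (M (full_sub C (Obj C - S))) X"
      "h' \<bullet> push (full_incl C (Obj C - S)) \<in> Hom A (M (full_sub C (Obj C - S))) X"
      using Cmp_in_Hom[OF push_in_Hom[OF i2]] h h' by auto
    fix i assume i: "i \<in> I"
    let ?e = "vertex_incl (full_sub C (Obj C - S)) (p i)"
    note e = vertex_incl_in_Hom[OF f2 pi[OF i]]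
    have v: "push (full_incl C (Obj C - S)) \<bullet> push ?e = push (vertex_incl C (p i))"
      using push_Cmp[OF e i2] full_incl_vertex_incl[OF C S(2), of "p i"] pi[OF i] by simp
    have "k \<bullet> push (full_incl C (Obj C - S)) \<bullet> push ?e = k \<bullet> push (vertex_incl C (p i))"
      if k: "k \<in> Hom A (M C) X" for k
      unfolding v[symmetric] by (rule Cmp_assoc[OF push_in_Hom[OF e] push_in_Hom[OF i2] k, symmetric])
    then show "h \<bullet> push (full_incl C (Obj C - S)) \<bullet> push ?e = h' \<bullet> push (full_incl C (Obj C - S)) \<bullet> push ?e"
      using h h' insert.prems(6)[of i] i by simp
  qed
  have d: "Dom A (push (full_incl C S)) = M (full_sub C S)" "Cod A (push (full_incl C S)) = M C"
     "Dom A (push (full_incl C (Obj C - S))) = M (full_sub C (Obj C - S))"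
    using push_in_Hom[OF i1] push_in_Hom[OF i2] by (simp_all add: in_Hom_iff)
  \<comment> \<open>Both h and h' solve the extension problem posed by the restrictions of h to the
    two parts.\<close>
  have "\<exists>!k. k \<in> Hom A (M C) X \<and> k \<bullet> push (full_incl C S) = h \<bullet> push (full_incl C S) \<and>
      k \<bullet> push (full_incl C (Obj C - S)) = h \<bullet> push (full_incl C (Obj C - S))"
    using coprod MC(2) Cmp_in_Hom[OF push_in_Hom[OF i1] h] Cmp_in_Hom[OF push_in_Hom[OF i2] h]
    unfolding is_coproduct_def d by blast
  then show ?case using h h' eq1 eq2 by metis
qed

text \<open>Since the vertex inclusions are jointly epic, it is enough to compare both sides after
  composition with \<open>push (vertex_incl C (p j))\<close>; there only the summand with i = j
  survives.\<close>

lemma Idn_decomposition: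
  assumes I: "finite I" and C: "finite_groupoid C" and p: "\<And>i. i \<in> I \<Longrightarrow> p i \<in> Obj C"
    and cover: "\<And>x. x \<in> Obj C \<Longrightarrow> \<exists>!i. i \<in> I \<and> Hom C (p i) x \<noteq> {}"
  shows "Idn A (M C) = finprod (hom_group A (M C) (M C))
    (\<lambda>i. push (vertex_incl C (p i)) \<bullet> pull (vertex_incl C (p i))) I"
proof -
  interpret C: finite_gpd C using C by (rule finite_gpdI)
  note MC = M_Obj[OF C]
  let ?v = "\<lambda>i. vertex_incl C (p i)"
  note v = vertex_incl_in_Hom[OF C p]
  have pp: "push (?v i) \<bullet> pull (?v i) \<in> Hom A (M C) (M C)" if "i \<in> I" for i
    by (rule Cmp_in_Hom[OF pull_in_Hom[OF v[OF that]] push_in_Hom[OF v[OF that]]])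
  have "Idn A (M C) \<bullet> push (?v j) = finprod (hom_group A (M C) (M C)) (\<lambda>i. push (?v i) \<bullet> pull (?v i)) I \<bullet> push (?v j)"
    if j: "j \<in> I" for j
  proof -
    let ?V = "M (gpd_of (vertex_group C (p j)))"
    note vj = push_in_Hom[OF v[OF j]]
    interpret V: comm_group "hom_group A ?V (M C)"
      using Hom_ends[OF vj] by (intro hom_comm_group) auto
    have "finprod (hom_group A (M C) (M C)) (\<lambda>i. push (?v i) \<bullet> pull (?v i)) I \<bullet> push (?v j) =
        finprod (hom_group A ?V (M C)) (\<lambda>i. push (?v i) \<bullet> pull (?v i) \<bullet> push (?v j)) I"
      by (rule Cmp_finprod_left[OF vj MC I pp])
    also have "\<dots> = finprod (hom_group A ?V (M C)) (\<lambda>i. if j = i then push (?v j) else \<one>\<^bsub>hom_group A ?V (M C)\<^esub>) I"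
    proof (rule V.finprod_cong')
      show "(\<lambda>i. if j = i then push (?v j) else \<one>\<^bsub>hom_group A ?V (M C)\<^esub>) \<in> I \<rightarrow> carrier (hom_group A ?V (M C))"
        using vj V.one_closed by (auto simp: hom_group_simps)
      fix i assume i: "i \<in> I"
      have "push (?v i) \<bullet> pull (?v i) \<bullet> push (?v j) = push (?v i) \<bullet> (pull (?v i) \<bullet> push (?v j))"
        by (rule Cmp_assoc[OF vj pull_in_Hom[OF v[OF i]] push_in_Hom[OF v[OF i]], symmetric])
      also have "\<dots> = (if j = i then push (?v j) else \<one>\<^bsub>hom_group A ?V (M C)\<^esub>)"
      proof (cases "j = i")
        case True
        then show ?thesis using pull_push_fully_faithful[OF v[OF j] vertex_incl_fully_faithful[OF C p[OF j]]]
          Cmp_Idn_right[OF vj] by simp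
      next
        case False
        \<comment> \<open>\<open>p j\<close> is joined to itself by its identity, hence by
          uniqueness in \<open>cover\<close> to no other chosen point.\<close>
        have "Hom C (p i) (p j) = {}"
          using False cover[OF p[OF j]] C.Idn_in_Hom[OF p[OF j]] i j by blast
        then have "pull (?v i) \<bullet> push (?v j) = Zero A ?V (M (gpd_of (vertex_group C (p i))))"
          by (intro pull_push_disjoint[OF v[OF j] v[OF i]]) (simp add: vertex_incl_def)
        then show ?thesis
          using False Cmp_Zero_right[OF push_in_Hom[OF v[OF i]], of ?V] Hom_ends[OF vj]
          by (simp add: hom_group_simps)
      qed
      finally show "push (?v i) \<bullet> pull (?v i) \<bullet> push (?v j) =
          (if j = i then push (?v j) else \<one>\<^bsub>hom_group A ?V (M C)\<^esub>)" .
    qed simp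
    also have "\<dots> = push (?v j)"
      using vj by (intro V.finprod_singleton[OF j I]) (simp add: hom_group_simps)
    finally show ?thesis by (simp add: Cmp_Idn_left[OF vj])
  qed
  then show ?thesis
    by (intro vertex_incl_jointly_epi[OF I C p cover Idn_in_Hom[OF MC] finprod_in_Hom[OF MC MC pp]]) auto
qed

end

section \<open>The pull-push formula for finite groups\<close>

locale webb_from_mackey = additive_mackey_functor +
  assumes surjections: "surjections_axiom A M push pull"
begin

abbreviation pushg where "pushg G H \<phi> \<equiv> push (gpd_map_of G H \<phi>)"
abbreviation pullg where "pullg G H \<phi> \<equiv> pull (gpd_map_of G H \<phi>)"

text \<open>\<open>I\<close> indexes the double cosets of \<gamma>(H) and \<delta>(K) in G, with
  representatives \<open>x i\<close>; \<open>cover\<close> says that every object of the fibered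
  product is joined to the chosen object of exactly one index. By \<open>stab\<close> and
  \<open>onto\<close>, \<open>L i\<close> maps onto the vertex group of that object through the pair
  of \<open>b i\<close> and \<open>a i\<close>. Leaving \<open>L i\<close> free lets each
  application use the group that occurs in its own statement.\<close>

lemma pull_push_formula:
  assumes G: "finite_group G" and H: "finite_group H" and K: "finite_group K"
    and \<gamma>: "\<gamma> \<in> hom H G" and \<delta>: "\<delta> \<in> hom K G"
    and I: "finite I" and x: "\<And>i. i \<in> I \<Longrightarrow> x i \<in> carrier G"
    and cover: "\<And>g. g \<in> carrier G \<Longrightarrow>
      \<exists>!i. i \<in> I \<and> (\<exists>h\<in>carrier H. \<exists>k\<in>carrier K. g \<otimes>\<^bsub>G\<^esub> \<delta> k = \<gamma> h \<otimes>\<^bsub>G\<^esub> x i)"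
    and L: "\<And>i. i \<in> I \<Longrightarrow> finite_group (L i)"
    and a: "\<And>i. i \<in> I \<Longrightarrow> a i \<in> hom (L i) H" and b: "\<And>i. i \<in> I \<Longrightarrow> b i \<in> hom (L i) K"
    and stab: "\<And>i l. i \<in> I \<Longrightarrow> l \<in> carrier (L i) \<Longrightarrow> x i \<otimes>\<^bsub>G\<^esub> \<delta> (b i l) = \<gamma> (a i l) \<otimes>\<^bsub>G\<^esub> x i"
    and onto: "\<And>i k h. i \<in> I \<Longrightarrow> k \<in> carrier K \<Longrightarrow> h \<in> carrier H \<Longrightarrow>
      x i \<otimes>\<^bsub>G\<^esub> \<delta> k = \<gamma> h \<otimes>\<^bsub>G\<^esub> x i \<Longrightarrow> \<exists>l\<in>carrier (L i). b i l = k \<and> a i l = h"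
  shows "pullg K G \<delta> \<bullet> pushg H G \<gamma> =
    finprod (hom_group A (M (gpd_of H)) (M (gpd_of K))) (\<lambda>i. pushg (L i) K (b i) \<bullet> pullg (L i) H (a i)) I"
proof -
  let ?d = "gpd_map_of K G \<delta>" and ?c = "gpd_map_of H G \<gamma>"
  note dm = gpd_map_of_in_Hom[OF K G \<delta>] and cm = gpd_map_of_in_Hom[OF H G \<gamma>]
  obtain F \<alpha> \<beta> c where "comma_square ?d ?c \<alpha> \<beta> (gpd_of K) (gpd_of H) (gpd_of G) F c"
    using ex_comma_square[OF dm cm] .
  then interpret S: comma_square ?d ?c \<alpha> \<beta> "gpd_of K" "gpd_of H" "gpd_of G" F c .
  note al = S.alpha and be = S.beta
  note fF = gpd_map_finite_Src[OF al]
  interpret F: finite_gpd F using fF by (rule finite_gpdI)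
  have ob: "OMap \<alpha> u = \<one>\<^bsub>H\<^esub>" "OMap \<beta> u = \<one>\<^bsub>K\<^esub>" "c u \<in> carrier G" if "u \<in> Obj F" for u
    using gpd_map_Obj[OF al that] gpd_map_Obj[OF be that] S.compare[OF that] by (auto simp: gpd_of_Hom)
  have arr: "AMap \<alpha> f \<in> carrier H" "AMap \<beta> f \<in> carrier K"
    "c v \<otimes>\<^bsub>G\<^esub> \<delta> (AMap \<beta> f) = \<gamma> (AMap \<alpha> f) \<otimes>\<^bsub>G\<^esub> c u" if "f \<in> Hom F u v" for f u v
    using gpd_map_Arr[OF al that] gpd_map_Arr[OF be that] S.compare_natural[OF that]
    by (auto simp: gpd_of_Hom)
  have ex_arr: "\<exists>f\<in>Hom F u v. AMap \<beta> f = k \<and> AMap \<alpha> f = h"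
    if "u \<in> Obj F" "v \<in> Obj F" "k \<in> carrier K" "h \<in> carrier H" "c v \<otimes>\<^bsub>G\<^esub> \<delta> k = \<gamma> h \<otimes>\<^bsub>G\<^esub> c u" for u v k h
    using S.ex_arrow[OF that(1,2), of k h] that(3-5) by (simp add: gpd_of_Hom ob that(1,2))
  \<comment> \<open>H and K have one object each, so the only datum to prescribe for an object of F
    is its comparison element in G.\<close>
  have "\<forall>i. \<exists>u. i \<in> I \<longrightarrow> u \<in> Obj F \<and> c u = x i"
    using S.ex_object[of "\<one>\<^bsub>K\<^esub>" "\<one>\<^bsub>H\<^esub>"] x by (fastforce simp: gpd_of_Hom)
  then obtain p where p: "\<And>i. i \<in> I \<Longrightarrow> p i \<in> Obj F" and cp: "\<And>i. i \<in> I \<Longrightarrow> c (p i) = x i" by metis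
  \<comment> \<open>The double coset relation is the compatibility condition for an arrow out of
    \<open>p i\<close>.\<close>
  have connected: "Hom F (p i) u \<noteq> {} \<longleftrightarrow> (\<exists>h\<in>carrier H. \<exists>k\<in>carrier K. c u \<otimes>\<^bsub>G\<^esub> \<delta> k = \<gamma> h \<otimes>\<^bsub>G\<^esub> x i)"
    if i: "i \<in> I" and u: "u \<in> Obj F" for i u
  proof
    assume "Hom F (p i) u \<noteq> {}"
    then obtain f where "f \<in> Hom F (p i) u" by blast
    then show "\<exists>h\<in>carrier H. \<exists>k\<in>carrier K. c u \<otimes>\<^bsub>G\<^esub> \<delta> k = \<gamma> h \<otimes>\<^bsub>G\<^esub> x i"
      using arr[of f "p i" u] cp[OF i] by auto
  next
    assume "\<exists>h\<in>carrier H. \<exists>k\<in>carrier K. c u \<otimes>\<^bsub>G\<^esub> \<delta> k = \<gamma> h \<otimes>\<^bsub>G\<^esub> x i"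
    then show "Hom F (p i) u \<noteq> {}" using ex_arr[OF p[OF i] u] cp[OF i] by auto
  qed
  have coverF: "\<exists>!i. i \<in> I \<and> Hom F (p i) u \<noteq> {}" if u: "u \<in> Obj F" for u
    using cover[OF ob(3)[OF u]] connected[OF _ u] by (metis (no_types, lifting))
  let ?MH = "M (gpd_of H)" and ?MK = "M (gpd_of K)"
  have MH: "?MH \<in> Obj A" "M F \<in> Obj A" "?MK \<in> Obj A"
    using M_Obj gpd_of_finite_groupoid H K fF by auto
  note pal = pull_in_Hom[OF al] and pbe = push_in_Hom[OF be]
  let ?v = "\<lambda>i. vertex_incl F (p i)"
  have summand: "push \<beta> \<bullet> (push (?v i) \<bullet> pull (?v i) \<bullet> pull \<alpha>) = pushg (L i) K (b i) \<bullet> pullg (L i) H (a i)"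
    if i: "i \<in> I" for i
  proof -
    let ?V = "vertex_group F (p i)"
    note V = vertex_group_finite_group[OF fF p[OF i]]
    note v = vertex_incl_in_Hom[OF fF p[OF i]]
    have bl: "b i l \<in> carrier K" and al': "a i l \<in> carrier H" if "l \<in> carrier (L i)" for l
      using a[OF i] b[OF i] that by (auto simp: hom_def)
    \<comment> \<open>By \<open>stab\<close> the pair of \<open>b i l\<close> and
      \<open>a i l\<close> is compatible at \<open>p i\<close>, hence comes from an arrow
      \<open>s l\<close>. As arrows are determined by their two projections, \<open>s\<close> is a
      homomorphism.\<close>
    have "\<forall>l. \<exists>f. l \<in> carrier (L i) \<longrightarrow> f \<in> Hom F (p i) (p i) \<and> AMap \<beta> f = b i l \<and> AMap \<alpha> f = a i l"
      using ex_arr[OF p[OF i] p[OF i] bl al'] stab[OF i] cp[OF i] by (metis (no_types, lifting))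
    then obtain s where s: "\<And>l. l \<in> carrier (L i) \<Longrightarrow> s l \<in> Hom F (p i) (p i)"
      and bs: "\<And>l. l \<in> carrier (L i) \<Longrightarrow> AMap \<beta> (s l) = b i l"
      and as: "\<And>l. l \<in> carrier (L i) \<Longrightarrow> AMap \<alpha> (s l) = a i l" by metis
    interpret L: group "L i" using L[OF i] by (simp add: finite_group_def)
    have "s \<in> hom (L i) ?V"
    proof (rule homI)
      fix l l' assume l: "l \<in> carrier (L i)" "l' \<in> carrier (L i)"
      then have ll: "l \<otimes>\<^bsub>L i\<^esub> l' \<in> carrier (L i)" by simp
      note sl = s[OF l(1)] s[OF l(2)]
      have "s (l \<otimes>\<^bsub>L i\<^esub> l') = s l \<bullet>\<^bsub>F\<^esub> s l'"
        using l ll by (intro S.arrow_unique[OF s[OF ll] F.Cmp_in_Hom[OF sl(2,1)]])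
          (simp_all add: gpd_map_Cmp[OF al sl(2,1)] gpd_map_Cmp[OF be sl(2,1)] as bs
            hom_mult[OF a[OF i]] hom_mult[OF b[OF i]])
      then show "s (l \<otimes>\<^bsub>L i\<^esub> l') = s l \<otimes>\<^bsub>?V\<^esub> s l'" by simp
    qed (simp add: s)
    moreover have "Hom F (p i) (p i) \<subseteq> s ` carrier (L i)"
    proof
      fix f assume f: "f \<in> Hom F (p i) (p i)"
      obtain l where "l \<in> carrier (L i)" "b i l = AMap \<beta> f" "a i l = AMap \<alpha> f"
        using onto[OF i arr(2,1)[OF f]] arr(3)[OF f] cp[OF i] by auto
      moreover from this have "s l = f" using S.arrow_unique[OF s f] as bs by simp
      ultimately show "f \<in> s ` carrier (L i)" by blast
    qed
    ultimately have epi: "s \<in> epi (L i) ?V" and hom: "s \<in> hom (L i) ?V"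
      using s by (auto simp: epi_def)
    let ?s = "gpd_map_of (L i) ?V s"
    note sm = gpd_map_of_in_Hom[OF L[OF i] V hom]
    \<comment> \<open>This is the identity that gets inserted between \<open>push\<close> and
      \<open>pull\<close> of the vertex inclusion; it turns the vertex group into
      \<open>L i\<close>.\<close>
    have id: "push ?s \<bullet> pull ?s = Idn A (M (gpd_of ?V))"
      using surjections L[OF i] V epi by (simp add: surjections_axiom_def)
    note vs = gpd_map_Cmp_in_Hom[OF sm v]
    have "\<beta> \<bullet>\<^bsub>FinGpd\<^esub> (?v i \<bullet>\<^bsub>FinGpd\<^esub> ?s) = gpd_map_of (L i) K (b i)"
      by (rule gpd_map_eqI[OF gpd_map_Cmp_in_Hom[OF vs be] gpd_map_of_in_Hom[OF L[OF i] K b[OF i]]])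
        (simp_all add: vertex_incl_def gpd_map_of_eq_mk_map s bs ob p[OF i])
    then have pb: "pushg (L i) K (b i) = push \<beta> \<bullet> (push (?v i) \<bullet> push ?s)"
      using push_Cmp[OF vs be] push_Cmp[OF sm v] by simp
    have "\<alpha> \<bullet>\<^bsub>FinGpd\<^esub> (?v i \<bullet>\<^bsub>FinGpd\<^esub> ?s) = gpd_map_of (L i) H (a i)"
      by (rule gpd_map_eqI[OF gpd_map_Cmp_in_Hom[OF vs al] gpd_map_of_in_Hom[OF L[OF i] H a[OF i]]])
        (simp_all add: vertex_incl_def gpd_map_of_eq_mk_map s as ob p[OF i])
    then have pa: "pullg (L i) H (a i) = pull ?s \<bullet> pull (?v i) \<bullet> pull \<alpha>"
      using pull_Cmp[OF vs al] pull_Cmp[OF sm v] by simp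
    note ps = push_in_Hom[OF sm] and ls = pull_in_Hom[OF sm]
      and pv = push_in_Hom[OF v] and lv = pull_in_Hom[OF v]
    note la = Cmp_in_Hom[OF pal lv]
    have "push (?v i) \<bullet> pull (?v i) \<bullet> pull \<alpha> = push (?v i) \<bullet> ((push ?s \<bullet> pull ?s) \<bullet> (pull (?v i) \<bullet> pull \<alpha>))"
      unfolding id by (simp add: Cmp_Idn_left[OF la] Cmp_assoc[OF pal lv pv])
    also have "\<dots> = (push (?v i) \<bullet> push ?s) \<bullet> (pull ?s \<bullet> (pull (?v i) \<bullet> pull \<alpha>))"
      by (simp add: Cmp_assoc[OF la ls ps, symmetric] Cmp_assoc[OF Cmp_in_Hom[OF la ls] ps pv])
    finally show ?thesis
      unfolding pa pb Cmp_assoc[OF pal lv ls, symmetric]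
      by (simp add: Cmp_assoc[OF Cmp_in_Hom[OF la ls] Cmp_in_Hom[OF ps pv] pbe])
  qed
  have pv: "push (?v i) \<bullet> pull (?v i) \<in> Hom A (M F) (M F)" if "i \<in> I" for i
    using vertex_incl_in_Hom[OF fF p[OF that]] by (blast intro: Cmp_in_Hom push_in_Hom pull_in_Hom)
  interpret HK: comm_group "hom_group A ?MH ?MK" using MH by (simp add: hom_comm_group)
  have dec: "Idn A (M F) = finprod (hom_group A (M F) (M F)) (\<lambda>i. push (?v i) \<bullet> pull (?v i)) I"
    by (rule Idn_decomposition[OF I fF p coverF])
  \<comment> \<open>The identity of \<open>M F\<close> is written into the Mackey axiom to make room
    for its decomposition.\<close>
  have "pullg K G \<delta> \<bullet> pushg H G \<gamma> = push \<beta> \<bullet> (Idn A (M F) \<bullet> pull \<alpha>)"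
    using fibered_products[OF dm cm S.fibered] by (simp add: Cmp_Idn_left[OF pal])
  also have "\<dots> = push \<beta> \<bullet> finprod (hom_group A ?MH (M F)) (\<lambda>i. push (?v i) \<bullet> pull (?v i) \<bullet> pull \<alpha>) I"
    unfolding dec by (subst Cmp_finprod_left[OF pal MH(2) I]) (simp_all add: pv)
  also have "\<dots> = finprod (hom_group A ?MH ?MK) (\<lambda>i. push \<beta> \<bullet> (push (?v i) \<bullet> pull (?v i) \<bullet> pull \<alpha>)) I"
    by (rule Cmp_finprod_right[OF pbe MH(1) I]) (rule Cmp_in_Hom[OF pal pv])
  also have "\<dots> = finprod (hom_group A ?MH ?MK) (\<lambda>i. pushg (L i) K (b i) \<bullet> pullg (L i) H (a i)) I"
  proof (rule HK.finprod_cong')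
    show "(\<lambda>i. pushg (L i) K (b i) \<bullet> pullg (L i) H (a i)) \<in> I \<rightarrow> carrier (hom_group A ?MH ?MK)"
      using gpd_map_of_in_Hom[OF L H a] gpd_map_of_in_Hom[OF L K b]
      by (auto simp: hom_group_simps intro!: Cmp_in_Hom[OF pull_in_Hom push_in_Hom])
  qed (simp_all add: summand)
  finally show ?thesis .
qed

text \<open>The case of a single double coset, represented by the unit: L is any group mapping onto
  the pairs with \<open>\<delta> k = \<gamma> h\<close>. It serves the axioms in which a surjection
  onto the common target is present.\<close>

lemma pull_push_transitive:
  assumes G: "finite_group G" and H: "finite_group H" and K: "finite_group K" and L: "finite_group L"
    and \<gamma>: "\<gamma> \<in> hom H G" and \<delta>: "\<delta> \<in> hom K G" and a: "a \<in> hom L H" and b: "b \<in> hom L K"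
    and cover: "\<And>g. g \<in> carrier G \<Longrightarrow> \<exists>h\<in>carrier H. \<exists>k\<in>carrier K. g \<otimes>\<^bsub>G\<^esub> \<delta> k = \<gamma> h"
    and commute: "\<And>l. l \<in> carrier L \<Longrightarrow> \<delta> (b l) = \<gamma> (a l)"
    and onto: "\<And>k h. k \<in> carrier K \<Longrightarrow> h \<in> carrier H \<Longrightarrow> \<delta> k = \<gamma> h \<Longrightarrow>
      \<exists>l\<in>carrier L. b l = k \<and> a l = h"
  shows "pullg K G \<delta> \<bullet> pushg H G \<gamma> = pushg L K b \<bullet> pullg L H a"
proof -
  interpret G: group G using G by (simp add: finite_group_def)
  have cl: "\<gamma> h \<in> carrier G" "\<delta> k \<in> carrier G" "a l \<in> carrier H"
    if "h \<in> carrier H" "k \<in> carrier K" "l \<in> carrier L" for h k l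
    using \<gamma> \<delta> a that by (auto simp: hom_def)
  have ne: "\<one>\<^bsub>H\<^esub> \<in> carrier H" "\<one>\<^bsub>K\<^esub> \<in> carrier K" "\<one>\<^bsub>L\<^esub> \<in> carrier L"
    using H K L by (auto simp: finite_group_def intro: monoid.one_closed group.is_monoid)
  let ?t = "pushg L K b \<bullet> pullg L H a"
  have t: "?t \<in> Hom A (M (gpd_of H)) (M (gpd_of K))"
    using gpd_map_of_in_Hom[OF L H a] gpd_map_of_in_Hom[OF L K b] by (blast intro: Cmp_in_Hom pull_in_Hom push_in_Hom)
  interpret HK: comm_group "hom_group A (M (gpd_of H)) (M (gpd_of K))"
    using Hom_ends[OF t] by (simp add: hom_comm_group)
  have "pullg K G \<delta> \<bullet> pushg H G \<gamma> = finprod (hom_group A (M (gpd_of H)) (M (gpd_of K))) (\<lambda>i. ?t) {()}"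
  proof (rule pull_push_formula[OF G H K \<gamma> \<delta>, where x = "\<lambda>_. \<one>\<^bsub>G\<^esub>"])
    show "\<exists>!i. i \<in> {()} \<and> (\<exists>h\<in>carrier H. \<exists>k\<in>carrier K. g \<otimes>\<^bsub>G\<^esub> \<delta> k = \<gamma> h \<otimes>\<^bsub>G\<^esub> \<one>\<^bsub>G\<^esub>)"
      if g: "g \<in> carrier G" for g
    proof -
      obtain h k where hk: "h \<in> carrier H" "k \<in> carrier K" "g \<otimes>\<^bsub>G\<^esub> \<delta> k = \<gamma> h"
        using cover[OF g] by blast
      then have "g \<otimes>\<^bsub>G\<^esub> \<delta> k = \<gamma> h \<otimes>\<^bsub>G\<^esub> \<one>\<^bsub>G\<^esub>" using cl(1) ne by simp
      with hk(1,2) show ?thesis by blast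
    qed
  qed (use L a b commute onto cl ne in auto)
  also have "\<dots> = ?t" using t HK.finprod_singleton[of "()" "{()}" "\<lambda>_. ?t"] by (simp add: hom_group_simps)
  finally show ?thesis .
qed

end

section \<open>Webb's axioms\<close>

lemma finite_group_subgrp: "finite_group G \<Longrightarrow> subgroup J G \<Longrightarrow> finite_group (subgrp G J)"
  by (auto simp: finite_group_def subgroup.subgroup_is_group dest: subgroup.subset intro: finite_subset)

text \<open>\<^const>\<open>conj_by\<close> and \<^const>\<open>double_coset\<close> exist only for records without extension fields,
  which the locale \<^locale>\<open>group\<close> does not guarantee.\<close>

locale plain_group = group G for G :: "'a monoid" (structure)
begin

lemma mult_inv_cancel:
  assumes "x \<in> carrier G" "y \<in> carrier G"
  shows "x \<otimes> (inv x \<otimes> y) = y" "inv x \<otimes> (x \<otimes> y) = y"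
  using assms by (simp_all flip: m_assoc)

lemma conj_by_hom: "x \<in> carrier G \<Longrightarrow> conj_by G x \<in> hom G G"
  by (rule homI) (simp_all add: conj_by_def m_assoc mult_inv_cancel)

lemma subgroup_conj_by_image:
  assumes "subgroup J G" "x \<in> carrier G"
  shows "subgroup (conj_by G x ` J) G"
proof -
  interpret group_hom G G "conj_by G x"
    using conj_by_hom[OF assms(2)] by unfold_locales
  show ?thesis using assms(1) by (rule subgroup_img_is_subgroup)
qed

text \<open>Replaces the existential hidden in the image by a direct condition on g, so that the
  intersection of J with a conjugate of K becomes the set of elements of J whose conjugate lies in
  K.\<close>

lemma mem_conj_by_inv_image:
  assumes "subgroup K G" "x \<in> carrier G" "g \<in> carrier G"
  shows "g \<in> conj_by G (inv x) ` K \<longleftrightarrow> conj_by G x g \<in> K"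
proof
  assume "g \<in> conj_by G (inv x) ` K"
  then obtain k where k: "k \<in> K" "g = inv x \<otimes> k \<otimes> x" using assms(2) by (auto simp: conj_by_def)
  then have "k \<in> carrier G" using assms(1) subgroup.mem_carrier by metis
  then have "conj_by G x g = k" using k(2) assms(2) by (simp add: conj_by_def m_assoc mult_inv_cancel)
  then show "conj_by G x g \<in> K" using k by simp
next
  assume *: "conj_by G x g \<in> K"
  have "g = conj_by G (inv x) (conj_by G x g)"
    using assms(2,3) by (simp add: conj_by_def m_assoc mult_inv_cancel)
  then show "g \<in> conj_by G (inv x) ` K" using * by blast
qed

lemma mem_double_coset:
  "h \<in> double_coset G K x J \<longleftrightarrow> (\<exists>k\<in>K. \<exists>j\<in>J. h = k \<otimes> (x \<otimes> j))"
  by (auto simp: double_coset_def set_mult_def l_coset_def)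

text \<open>The fibered product of J and K over G produces double cosets J g K, while
  \<open>double_coset\<close> has the shape K x J; inversion exchanges the two. The right side is
  the relation in the \<open>cover\<close> hypothesis of \<open>pull_push_formula\<close> with
  representative \<open>inv x\<close>.\<close>

lemma inv_mem_double_coset:
  assumes J: "subgroup J G" and K: "subgroup K G" and x: "x \<in> carrier G" and g: "g \<in> carrier G"
  shows "inv g \<in> double_coset G K x J \<longleftrightarrow> (\<exists>j\<in>J. \<exists>k\<in>K. g \<otimes> k = j \<otimes> inv x)"
proof
  assume "inv g \<in> double_coset G K x J"
  then obtain k j where kj: "k \<in> K" "j \<in> J" "inv g = k \<otimes> (x \<otimes> j)" by (auto simp: mem_double_coset)
  have c: "k \<in> carrier G" "j \<in> carrier G" using kj J K subgroup.mem_carrier by metis+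
  have "g = inv (k \<otimes> (x \<otimes> j))" using kj(3) g inv_inv by metis
  then have "g \<otimes> k = inv j \<otimes> inv x" using c x by (simp add: inv_mult_group m_assoc)
  then show "\<exists>j\<in>J. \<exists>k\<in>K. g \<otimes> k = j \<otimes> inv x" using kj subgroup.m_inv_closed[OF J] by blast
next
  assume "\<exists>j\<in>J. \<exists>k\<in>K. g \<otimes> k = j \<otimes> inv x"
  then obtain j k where kj: "k \<in> K" "j \<in> J" "g \<otimes> k = j \<otimes> inv x" by blast
  have c: "k \<in> carrier G" "j \<in> carrier G" using kj J K subgroup.mem_carrier by metis+
  have "g = g \<otimes> k \<otimes> inv k" using c g by (simp add: m_assoc)
  then have "g = j \<otimes> inv x \<otimes> inv k" using kj(3) by simp
  then have "inv g = k \<otimes> (x \<otimes> inv j)" using c x by (simp add: inv_mult_group m_assoc)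
  then show "inv g \<in> double_coset G K x J"
    using kj subgroup.m_inv_closed[OF J] by (auto simp: mem_double_coset)
qed

end

section \<open>Axioms (2) to (5) for the restricted functor\<close>

context webb_from_mackey
begin

text \<open>As a functor, conjugation by x is naturally isomorphic to the identity through the
  single component \<open>inv x\<close>, because \<open>inv x \<otimes> (x \<otimes> f \<otimes> inv
  x) = f \<otimes> inv x\<close>.\<close>

lemma webb_inner:
  assumes G: "finite_group G" and x: "x \<in> carrier G"
  shows "pushg G G (conj_by G x) = Idn A (M (gpd_of G)) \<and> pullg G G (conj_by G x) = Idn A (M (gpd_of G))"
proof -
  interpret G: plain_group G using G by (simp add: plain_group_def finite_group_def)
  note fG = gpd_of_finite_groupoid[OF G]
  have "naturally_isomorphic (gpd_map_of G G (conj_by G x)) (Idn FinGpd (gpd_of G))"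
    by (rule naturally_isomorphicI[OF gpd_map_of_in_Hom[OF G G G.conj_by_hom[OF x]]
        Idn_in_Hom_FinGpd[OF fG], where \<eta> = "\<lambda>_. inv\<^bsub>G\<^esub> x"])
      (use x in \<open>auto simp: gpd_of_Hom conj_by_def G.m_assoc G.mult_inv_cancel\<close>)
  then show ?thesis using natural_isomorphisms push_Idn[OF fG] pull_Idn[OF fG] by metis
qed

text \<open>P is isomorphic to the group of pairs (k, g) in K and G with k = \<beta>(g).
  Surjectivity of \<beta> leaves a single double coset, and the two equations differ only in which
  of the two maps is pulled back.\<close>

lemma webb_restrict_surjection:
  assumes G: "finite_group G" and H: "finite_group H" and \<beta>: "\<beta> \<in> epi G H" and K: "subgroup K H"
    and P: "P = {g \<in> carrier G. \<beta> g \<in> K}"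
  shows "pullg (subgrp H K) H (\<lambda>h. h) \<bullet> pushg G H \<beta> =
      pushg (subgrp G P) (subgrp H K) \<beta> \<bullet> pullg (subgrp G P) G (\<lambda>g. g) \<and>
    pullg G H \<beta> \<bullet> pushg (subgrp H K) H (\<lambda>h. h) =
      pushg (subgrp G P) G (\<lambda>g. g) \<bullet> pullg (subgrp G P) (subgrp H K) \<beta>"
proof -
  interpret G: plain_group G using G by (simp add: plain_group_def finite_group_def)
  interpret H: plain_group H using H by (simp add: plain_group_def finite_group_def)
  interpret K: subgroup K H by (rule K)
  have hom: "\<beta> \<in> hom G H" and surj: "\<beta> ` carrier G = carrier H" using \<beta> by (auto simp: epi_def)
  interpret b: group_hom G H \<beta> using hom by unfold_locales
  have "subgroup P G" by (rule G.subgroupI) (auto simp: P intro: exI[of _ "\<one>\<^bsub>G\<^esub>"])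
  note fP = finite_group_subgrp[OF G this] and fK = finite_group_subgrp[OF H K]
  have incl: "(\<lambda>h. h) \<in> hom (subgrp H K) H" "(\<lambda>g. g) \<in> hom (subgrp G P) G"
    "\<beta> \<in> hom (subgrp G P) (subgrp H K)"
    by (auto simp: hom_def P)
  have "pullg (subgrp H K) H (\<lambda>h. h) \<bullet> pushg G H \<beta> =
      pushg (subgrp G P) (subgrp H K) \<beta> \<bullet> pullg (subgrp G P) G (\<lambda>g. g)"
  proof (rule pull_push_transitive[OF H G fK fP hom incl(1,2,3)])
    fix h assume h: "h \<in> carrier H"
    then obtain g where "g \<in> carrier G" "\<beta> g = h" using surj by (metis imageE)
    then show "\<exists>g\<in>carrier G. \<exists>k\<in>carrier (subgrp H K). h \<otimes>\<^bsub>H\<^esub> k = \<beta> g"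
      using h by (intro bexI[of _ g] bexI[of _ "\<one>\<^bsub>H\<^esub>"]) auto
  qed (auto simp: P)
  moreover have "pullg G H \<beta> \<bullet> pushg (subgrp H K) H (\<lambda>h. h) =
      pushg (subgrp G P) G (\<lambda>g. g) \<bullet> pullg (subgrp G P) (subgrp H K) \<beta>"
  proof (rule pull_push_transitive[OF H fK G fP incl(1) hom incl(3,2)])
    fix h assume h: "h \<in> carrier H"
    \<comment> \<open>Here \<beta> multiplies h from the right, so a preimage of the inverse of h
      brings the product to the unit, which lies in K.\<close>
    then obtain g where g: "g \<in> carrier G" "\<beta> g = inv\<^bsub>H\<^esub> h" using surj by (metis imageE H.inv_closed)
    then have "h \<otimes>\<^bsub>H\<^esub> \<beta> g = \<one>\<^bsub>H\<^esub>" using h by simp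
    then show "\<exists>k\<in>carrier (subgrp H K). \<exists>g\<in>carrier G. h \<otimes>\<^bsub>H\<^esub> \<beta> g = k" using g(1) by auto
  qed (auto simp: P)
  ultimately show ?thesis ..
qed

text \<open>The content is that H maps onto the pairs (k, g) with
  \<open>\<delta> k = \<gamma> g\<close>. If h1 lies over k and h2 over g, equality in Q means that
  h1 and h2 differ by a product of an element of ker \<alpha> and one of ker \<beta>, and each of
  the two maps absorbs one factor.\<close>

lemma webb_two_surjections:
  assumes H: "finite_group H" and G: "finite_group G" and K: "finite_group K"
    and \<beta>: "\<beta> \<in> epi H G" and \<alpha>: "\<alpha> \<in> epi H K" and N: "N = kernel H K \<alpha> <#>\<^bsub>H\<^esub> kernel H G \<beta>"
    and Q: "finite_group Q" and \<theta>: "\<theta> \<in> iso (H Mod N) Q" and \<gamma>: "\<gamma> \<in> epi G Q" and \<delta>: "\<delta> \<in> epi K Q"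
    and \<gamma>\<beta>: "\<forall>h\<in>carrier H. \<gamma> (\<beta> h) = \<theta> (N #>\<^bsub>H\<^esub> h)"
    and \<delta>\<alpha>: "\<forall>h\<in>carrier H. \<delta> (\<alpha> h) = \<theta> (N #>\<^bsub>H\<^esub> h)"
  shows "pullg K Q \<delta> \<bullet> pushg G Q \<gamma> = pushg H K \<alpha> \<bullet> pullg H G \<beta>"
proof -
  interpret G: plain_group G using G by (simp add: plain_group_def finite_group_def)
  interpret H: plain_group H using H by (simp add: plain_group_def finite_group_def)
  interpret K: group K using K by (simp add: finite_group_def)
  interpret Q: group Q using Q by (simp add: finite_group_def)
  have hom: "\<beta> \<in> hom H G" "\<alpha> \<in> hom H K" "\<gamma> \<in> hom G Q" "\<delta> \<in> hom K Q"
    and surj: "\<beta> ` carrier H = carrier G" "\<alpha> ` carrier H = carrier K" "\<gamma> ` carrier G = carrier Q"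
    using \<beta> \<alpha> \<gamma> \<delta> by (auto simp: epi_def)
  interpret b: group_hom H G \<beta> using hom(1) by unfold_locales
  interpret a: group_hom H K \<alpha> using hom(2) by unfold_locales
  interpret d: group_hom K Q \<delta> using hom(4) by unfold_locales
  have one_N: "\<one>\<^bsub>H\<^esub> \<in> N" by (force simp: N set_mult_def kernel_def)
  show ?thesis
  proof (rule pull_push_transitive[OF Q G K H hom(3,4,1,2)])
    fix q assume q: "q \<in> carrier Q"
    then obtain g where "g \<in> carrier G" "\<gamma> g = q" using surj(3) by (metis imageE)
    then show "\<exists>g\<in>carrier G. \<exists>k\<in>carrier K. q \<otimes>\<^bsub>Q\<^esub> \<delta> k = \<gamma> g"
      using q by (intro bexI[of _ g] bexI[of _ "\<one>\<^bsub>K\<^esub>"]) auto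
  next
    fix h assume "h \<in> carrier H"
    then show "\<delta> (\<alpha> h) = \<gamma> (\<beta> h)" using \<gamma>\<beta> \<delta>\<alpha> by simp
  next
    fix k g assume "k \<in> carrier K" "g \<in> carrier G" and eq: "\<delta> k = \<gamma> g"
    then obtain h1 h2 where h1: "h1 \<in> carrier H" "\<alpha> h1 = k" and h2: "h2 \<in> carrier H" "\<beta> h2 = g"
      using surj(1,2) by (metis imageE)
    have "\<theta> (N #>\<^bsub>H\<^esub> h1) = \<theta> (N #>\<^bsub>H\<^esub> h2)" using eq h1 h2 \<gamma>\<beta> \<delta>\<alpha> by auto
    moreover have "inj_on \<theta> (rcosets\<^bsub>H\<^esub> N)"
      using \<theta> by (simp add: iso_def bij_betw_def FactGroup_def)
    moreover have "N #>\<^bsub>H\<^esub> h1 \<in> rcosets\<^bsub>H\<^esub> N" "N #>\<^bsub>H\<^esub> h2 \<in> rcosets\<^bsub>H\<^esub> N"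
      using h1 h2 by (auto simp: RCOSETS_def)
    ultimately have "N #>\<^bsub>H\<^esub> h1 = N #>\<^bsub>H\<^esub> h2" by (meson inj_onD)
    moreover have "h1 \<in> N #>\<^bsub>H\<^esub> h1" using one_N h1 by (force simp: r_coset_def)
    ultimately obtain n where "n \<in> N" "h1 = n \<otimes>\<^bsub>H\<^esub> h2" by (auto simp: r_coset_def)
    then obtain u v where u: "u \<in> carrier H" "\<alpha> u = \<one>\<^bsub>K\<^esub>" and v: "v \<in> carrier H" "\<beta> v = \<one>\<^bsub>G\<^esub>"
      and eq': "h1 = u \<otimes>\<^bsub>H\<^esub> v \<otimes>\<^bsub>H\<^esub> h2" by (auto simp: N set_mult_def kernel_def)
    \<comment> \<open>The product of v and h2 differs from h1 by u, which \<alpha> kills, and from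
      h2 by v, which \<beta> kills; so it lies over k and over g at once.\<close>
    have "\<alpha> h1 = \<alpha> (v \<otimes>\<^bsub>H\<^esub> h2)" "\<beta> (v \<otimes>\<^bsub>H\<^esub> h2) = g" using u v h2 by (auto simp: eq')
    then show "\<exists>l\<in>carrier H. \<alpha> l = k \<and> \<beta> l = g" using h1 h2 v by (intro bexI[of _ "v \<otimes>\<^bsub>H\<^esub> h2"]) auto
  qed
qed

text \<open>In the general formula the double coset of x is represented by \<open>inv x\<close>. The
  compatibility condition \<open>inv x \<otimes> k = h \<otimes> inv x\<close> says that k is the
  conjugate of h by x, so the vertex group is the graph of this conjugation on
  \<open>Jx\<close>.\<close>

lemma webb_double_coset_formula:
  assumes H: "finite_group H" and J: "subgroup J H" and K: "subgroup K H" and R: "double_coset_reps H K J R"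
  shows "pullg (subgrp H K) H (\<lambda>h. h) \<bullet> pushg (subgrp H J) H (\<lambda>h. h) =
    (\<Otimes>\<^bsub>hom_group A (M (gpd_of (subgrp H J))) (M (gpd_of (subgrp H K)))\<^esub> x\<in>R.
       (let Jx = J \<inter> conj_by H (inv\<^bsub>H\<^esub> x) ` K;
            xJ = conj_by H x ` J \<inter> K
        in pushg (subgrp H xJ) (subgrp H K) (\<lambda>h. h) \<bullet>
           pushg (subgrp H Jx) (subgrp H xJ) (conj_by H x) \<bullet>
           pullg (subgrp H Jx) (subgrp H J) (\<lambda>h. h)))"
proof -
  interpret H: plain_group H using H by (simp add: plain_group_def finite_group_def)
  interpret J: subgroup J H by (rule J)
  interpret K: subgroup K H by (rule K)
  note fJ = finite_group_subgrp[OF H J] and fK = finite_group_subgrp[OF H K]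
  have R_carrier: "x \<in> carrier H" if "x \<in> R" for x using R that by (auto simp: double_coset_reps_def)
  then have "finite R" using H by (auto simp: finite_group_def intro: finite_subset)
  define Jx where "Jx x = J \<inter> conj_by H (inv\<^bsub>H\<^esub> x) ` K" for x
  define xJ where "xJ x = conj_by H x ` J \<inter> K" for x
  have Jx_iff: "g \<in> Jx x \<longleftrightarrow> g \<in> J \<and> conj_by H x g \<in> K" if "x \<in> R" for x g
    using H.mem_conj_by_inv_image[OF K R_carrier[OF that], of g] by (auto simp: Jx_def)
  have fJx: "finite_group (subgrp H (Jx x))" if "x \<in> R" for x
    unfolding Jx_def using that
    by (intro finite_group_subgrp[OF H] H.subgroups_Inter_pair J H.subgroup_conj_by_image K) (simp add: R_carrier)
  have fxJ: "finite_group (subgrp H (xJ x))" if "x \<in> R" for x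
    unfolding xJ_def using that
    by (intro finite_group_subgrp[OF H] H.subgroups_Inter_pair K H.subgroup_conj_by_image J) (simp add: R_carrier)
  have incl: "(\<lambda>h. h) \<in> hom (subgrp H J) H" "(\<lambda>h. h) \<in> hom (subgrp H K) H" by (auto simp: hom_def)
  have a: "(\<lambda>h. h) \<in> hom (subgrp H (Jx x)) (subgrp H J)" for x by (auto simp: hom_def Jx_def)
  have c: "(\<lambda>h. h) \<in> hom (subgrp H (xJ x)) (subgrp H K)" for x by (auto simp: hom_def xJ_def)
  have conj: "conj_by H x \<in> hom (subgrp H (Jx x)) (subgrp H (xJ x))" if "x \<in> R" for x
    using H.conj_by_hom[OF R_carrier[OF that]] Jx_iff[OF that] by (auto simp: hom_def xJ_def)
  have b: "conj_by H x \<in> hom (subgrp H (Jx x)) (subgrp H K)" if "x \<in> R" for x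
    using conj[OF that] by (auto simp: hom_def xJ_def)
  let ?hg = "hom_group A (M (gpd_of (subgrp H J))) (M (gpd_of (subgrp H K)))"
  have "pullg (subgrp H K) H (\<lambda>h. h) \<bullet> pushg (subgrp H J) H (\<lambda>h. h) =
    finprod ?hg (\<lambda>x. pushg (subgrp H (Jx x)) (subgrp H K) (conj_by H x) \<bullet>
      pullg (subgrp H (Jx x)) (subgrp H J) (\<lambda>h. h)) R"
  proof (rule pull_push_formula[OF H fJ fK incl \<open>finite R\<close>, where x = "\<lambda>x. inv\<^bsub>H\<^esub> x"])
    fix g assume g: "g \<in> carrier H"
    then have "\<exists>!x. x \<in> R \<and> inv\<^bsub>H\<^esub> g \<in> double_coset H K x J" using R by (simp add: double_coset_reps_def)
    then show "\<exists>!x. x \<in> R \<and> (\<exists>h\<in>carrier (subgrp H J). \<exists>k\<in>carrier (subgrp H K). g \<otimes>\<^bsub>H\<^esub> k = h \<otimes>\<^bsub>H\<^esub> inv\<^bsub>H\<^esub> x)"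
      using H.inv_mem_double_coset[OF J K R_carrier g] by (simp cong: conj_cong)
  next
    fix x l assume "x \<in> R" "l \<in> carrier (subgrp H (Jx x))"
    then have "x \<in> carrier H" "l \<in> carrier H" by (auto simp: R_carrier Jx_def)
    then show "inv\<^bsub>H\<^esub> x \<otimes>\<^bsub>H\<^esub> conj_by H x l = l \<otimes>\<^bsub>H\<^esub> inv\<^bsub>H\<^esub> x"
      by (simp add: conj_by_def H.m_assoc H.mult_inv_cancel)
  next
    fix x k h assume x: "x \<in> R" and "k \<in> carrier (subgrp H K)" "h \<in> carrier (subgrp H J)"
      and eq: "inv\<^bsub>H\<^esub> x \<otimes>\<^bsub>H\<^esub> k = h \<otimes>\<^bsub>H\<^esub> inv\<^bsub>H\<^esub> x"
    then have k: "k \<in> K" "k \<in> carrier H" and h: "h \<in> J" "h \<in> carrier H" by auto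
    have "conj_by H x h = x \<otimes>\<^bsub>H\<^esub> (inv\<^bsub>H\<^esub> x \<otimes>\<^bsub>H\<^esub> k)"
      using R_carrier[OF x] h by (simp add: conj_by_def H.m_assoc eq)
    then have "conj_by H x h = k" using R_carrier[OF x] k by (simp add: H.m_assoc[symmetric])
    then show "\<exists>l\<in>carrier (subgrp H (Jx x)). conj_by H x l = k \<and> l = h"
      using h k Jx_iff[OF x] by simp
  qed (simp_all add: R_carrier fJx a b)
  \<comment> \<open>The general formula has a single push, along conjugation from
    \<open>Jx x\<close> into K; the required summand factors it through \<open>xJ x\<close>.\<close>
  also have "\<dots> = finprod ?hg (\<lambda>x. pushg (subgrp H (xJ x)) (subgrp H K) (\<lambda>h. h) \<bullet>
           pushg (subgrp H (Jx x)) (subgrp H (xJ x)) (conj_by H x) \<bullet>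
           pullg (subgrp H (Jx x)) (subgrp H J) (\<lambda>h. h)) R"
  proof -
    interpret hg: comm_group ?hg
      by (intro hom_comm_group M_Obj gpd_of_finite_groupoid fJ fK)
    have eq: "pushg (subgrp H (xJ x)) (subgrp H K) (\<lambda>h. h) \<bullet> pushg (subgrp H (Jx x)) (subgrp H (xJ x)) (conj_by H x) =
        pushg (subgrp H (Jx x)) (subgrp H K) (conj_by H x)" if x: "x \<in> R" for x
      using push_Cmp[OF gpd_map_of_in_Hom[OF fJx[OF x] fxJ[OF x] conj[OF x]] gpd_map_of_in_Hom[OF fxJ[OF x] fK c]]
      by (simp add: gpd_map_of_Cmp[OF conj[OF x]] comp_def)
    show ?thesis
    proof (rule hg.finprod_cong')
      show "(\<lambda>x. pushg (subgrp H (xJ x)) (subgrp H K) (\<lambda>h. h) \<bullet>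
           pushg (subgrp H (Jx x)) (subgrp H (xJ x)) (conj_by H x) \<bullet>
           pullg (subgrp H (Jx x)) (subgrp H J) (\<lambda>h. h)) \<in> R \<rightarrow> carrier ?hg"
        using Cmp_in_Hom[OF pull_in_Hom[OF gpd_map_of_in_Hom[OF fJx fJ a]] push_in_Hom[OF gpd_map_of_in_Hom[OF fJx fK b]]]
        by (simp add: eq hom_group_simps)
    qed (simp_all add: eq)
  qed
  finally show ?thesis by (simp add: Jx_def xJ_def Let_def)
qed

end

theorem propositionA1:
  fixes A :: "('o, 'm, 'z) additive_cat_scheme"
    and M :: "'u::infinite gpd \<Rightarrow> 'o"
    and push :: "'u gpd_map \<Rightarrow> 'm"
    and pull :: "'u gpd_map \<Rightarrow> 'm"
  assumes "additive_category A"
    and "globally_defined_mackey_functor A M push pull"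
    and "surjections_axiom A M push pull"
  shows "webb_global_mackey_functor A
           (\<lambda>G. M (gpd_of G))
           (\<lambda>G H \<phi>. push (gpd_map_of G H \<phi>))
           (\<lambda>G H \<phi>. pull (gpd_map_of G H \<phi>))"
proof -
  interpret webb_from_mackey A M push pull
    using assms by (simp add: webb_from_mackey_def additive_mackey_functor_def webb_from_mackey_axioms_def)
  show ?thesis
  proof (rule webb_global_mackey_functor.intro)
    fix G :: "'u monoid" assume "finite_group G"
    then show "M (gpd_of G) \<in> Obj A" by (simp add: M_Obj gpd_of_finite_groupoid)
  next
    fix G K :: "'u monoid" and \<alpha> assume "finite_group G" "finite_group K" "\<alpha> \<in> hom G K"
    note m = gpd_map_of_in_Hom[OF this]
    show "pushg G K \<alpha> \<in> Hom A (M (gpd_of G)) (M (gpd_of K))"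
      "pullg G K \<alpha> \<in> Hom A (M (gpd_of K)) (M (gpd_of G))"
      by (rule push_in_Hom[OF m], rule pull_in_Hom[OF m])
  next
    fix G K :: "'u monoid" and \<alpha> \<alpha>' :: "'u \<Rightarrow> 'u" assume "\<forall>g\<in>carrier G. \<alpha> g = \<alpha>' g"
    then show "pushg G K \<alpha> = pushg G K \<alpha>' \<and> pullg G K \<alpha> = pullg G K \<alpha>'"
      using gpd_map_of_cong[of G \<alpha> \<alpha>' K] by simp
  next
    fix G H K :: "'u monoid" and \<beta> \<alpha> assume G: "finite_group G" and H: "finite_group H" and K: "finite_group K"
      and \<beta>: "\<beta> \<in> hom G H" and \<alpha>: "\<alpha> \<in> hom H K"
    note m = gpd_map_of_in_Hom[OF G H \<beta>] gpd_map_of_in_Hom[OF H K \<alpha>]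
    show "pushg G K (\<alpha> \<circ> \<beta>) = pushg H K \<alpha> \<bullet>\<^bsub>A\<^esub> pushg G H \<beta> \<and>
        pullg G K (\<alpha> \<circ> \<beta>) = pullg G H \<beta> \<bullet>\<^bsub>A\<^esub> pullg H K \<alpha>"
      using push_Cmp[OF m] pull_Cmp[OF m] by (simp add: gpd_map_of_Cmp[OF \<beta>])
  next
    fix G :: "'u monoid" assume "finite_group G"
    then have "finite_groupoid (gpd_of G)" by (rule gpd_of_finite_groupoid)
    then show "pushg G G (\<lambda>g. g) = Idn A (M (gpd_of G)) \<and> pullg G G (\<lambda>g. g) = Idn A (M (gpd_of G))"
      unfolding gpd_map_of_Idn by (intro conjI push_Idn pull_Idn)
  qed (fact webb_inner webb_restrict_surjection webb_two_surjections webb_double_coset_formula)+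
qed

end
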